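(* Let $(b,a)$ be a Pythagorean pair such that $\phi:=b/a\in H^2$, and let $f\in H^2$. (i) For each $m\in\mathbb{Z}$ we have $$\sum_{n\ge0}\bigl|\overline{\hat{\phi}(n)}\hat{f}(m+n)\bigr|<\infty.$$ (ii) We have $f\in\mathcal{H}(b)$ if and only if $$\sum_{m\ge0}\Bigl|\sum_{n\ge0}\overline{\hat{\phi}(n)}\hat{f}(m+n)\Bigr|^2<\infty,$$ in which case $$\|f\|_{\mathcal{H}(b)}^2=\sum_{m\ge0}|\hat{f}(m)|^2+\sum_{m\ge0}\Bigl|\sum_{n\ge0}\overline{\hat{\phi}(n)}\hat{f}(m+n)\Bigr|^2.$$
   Context: $\mathbb{D}$ is the open unit disk, $\mathbb{T}$ the unit circle, and $H^p$ ($0<p\le\infty$) the Hardy spaces on $\mathbb{D}$. A Pythagorean pair is a pair $(b,a)$ of functions in $H^\infty$ such that $|b|^2+|a|^2=1$ a.e. on $\mathbb{T}$, $a$ is outer and $a(0)>0$. For $b\in H^\infty$ with $\|b\|_{H^\infty}\le1$, the de Branges--Rovnyak space $\mathcal{H}(b)$ is the Hilbert space of functions on $\mathbb{D}$ with reproducing kernel $(z,w)\mapsto (1-\overline{b(w)}b(z))/(1-\overline{w}z)$; it is contractively contained in $H^2$. For $f$ holomorphic on $\mathbb{D}$, $\hat{f}(n)$ denotes the $n$-th Taylor coefficient of $f$ at $0$ for $n\ge0$, with the convention $\hat{f}(j)=0$ for $j<0$. *)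

theory Defs
  imports "HOL-Complex_Analysis.Complex_Analysis"
begin

text \<open>Functions on the open unit disk are total functions on the complex plane of which only
  the restriction to \<^term>\<open>ball (0::complex) 1\<close> matters.\<close>

definition hardy_infinity :: "(complex \<Rightarrow> complex) set" where
  "hardy_infinity = {f. f holomorphic_on ball 0 1 \<and> bounded (f ` ball 0 1)}"

definition hardy2 :: "(complex \<Rightarrow> complex) set" where
  "hardy2 = {f. f holomorphic_on ball 0 1 \<and>
     bdd_above ((\<lambda>r::real. (1 / (2 * pi)) *
       integral {0..2 * pi} (\<lambda>t. (cmod (f (of_real r * cis t)))\<^sup>2)) ` {0..<1})}"

definition taylor_coeff :: "(complex \<Rightarrow> complex) \<Rightarrow> int \<Rightarrow> complex" where
  "taylor_coeff f n = (if n < 0 then 0 else (deriv ^^ nat n) f 0 / fact (nat n))"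

text \<open>The boundary value of \<open>f\<close> at a point of the unit circle is the radial limit; by Fatou's
  theorem it exists almost everywhere for \<open>f\<close> in a Hardy space.\<close>

definition has_boundary_value :: "(complex \<Rightarrow> complex) \<Rightarrow> complex \<Rightarrow> complex \<Rightarrow> bool" where
  "has_boundary_value f \<zeta> l \<longleftrightarrow> ((\<lambda>r::real. f (of_real r * \<zeta>)) \<longlongrightarrow> l) (at_left 1)"

text \<open>The weight \<open>k\<close> on the circle is written as a function of the angle \<open>t\<close>.\<close>

definition outer :: "(complex \<Rightarrow> complex) \<Rightarrow> bool" where
  "outer f \<longleftrightarrow> (\<exists>(c::complex) (k::real \<Rightarrow> real).
     cmod c = 1 \<and>
     k \<in> borel_measurable (lebesgue_on {0..2 * pi}) \<and>
     (\<forall>t\<in>{0..2 * pi}. 0 < k t) \<and>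
     integrable (lebesgue_on {0..2 * pi}) (\<lambda>t. ln (k t)) \<and>
     (\<forall>z\<in>ball 0 1. f z = c * exp ((1 / (2 * pi)) *
        (LINT t|lebesgue_on {0..2 * pi}. (cis t + z) / (cis t - z) * of_real (ln (k t))))))"

definition pythagorean_pair :: "(complex \<Rightarrow> complex) \<Rightarrow> (complex \<Rightarrow> complex) \<Rightarrow> bool" where
  "pythagorean_pair b a \<longleftrightarrow>
     b \<in> hardy_infinity \<and> a \<in> hardy_infinity \<and>
     (AE t in lebesgue_on {0..2 * pi}. \<exists>\<beta> \<alpha>.
        has_boundary_value b (cis t) \<beta> \<and> has_boundary_value a (cis t) \<alpha> \<and>
        (cmod \<beta>)\<^sup>2 + (cmod \<alpha>)\<^sup>2 = 1) \<and>
     outer a \<and> a 0 \<in> \<real> \<and> 0 < Re (a 0)"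

text \<open>\<open>H\<close> with inner product \<open>ip\<close> (linear in the first argument) is the Hilbert space of
  functions on \<open>X\<close> with reproducing kernel \<open>K\<close>; by the Moore--Aronszajn theorem it is
  determined by \<open>K\<close>. Functions agreeing on \<open>X\<close> represent the same element: \<open>H\<close> is
  closed under this identification, and \<open>ip_eq_0_iff\<close> makes \<open>ip\<close> respect it.\<close>

locale reproducing_kernel_hilbert_space =
  fixes X :: "'a set"
    and K :: "'a \<Rightarrow> 'a \<Rightarrow> complex"
    and H :: "('a \<Rightarrow> complex) set"
    and ip :: "('a \<Rightarrow> complex) \<Rightarrow> ('a \<Rightarrow> complex) \<Rightarrow> complex"
  assumes mem_cong: "f \<in> H \<Longrightarrow> (\<And>x. x \<in> X \<Longrightarrow> g x = f x) \<Longrightarrow> g \<in> H"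
    and zero_mem: "(\<lambda>_. 0) \<in> H"
    and add_mem: "f \<in> H \<Longrightarrow> g \<in> H \<Longrightarrow> (\<lambda>x. f x + g x) \<in> H"
    and scale_mem: "f \<in> H \<Longrightarrow> (\<lambda>x. c * f x) \<in> H"
    and ip_add_left: "f \<in> H \<Longrightarrow> g \<in> H \<Longrightarrow> h \<in> H \<Longrightarrow> ip (\<lambda>x. f x + g x) h = ip f h + ip g h"
    and ip_scale_left: "f \<in> H \<Longrightarrow> g \<in> H \<Longrightarrow> ip (\<lambda>x. c * f x) g = c * ip f g"
    and ip_commute: "f \<in> H \<Longrightarrow> g \<in> H \<Longrightarrow> ip f g = cnj (ip g f)"
    and ip_nonneg: "f \<in> H \<Longrightarrow> 0 \<le> Re (ip f f)"
    and ip_eq_0_iff: "f \<in> H \<Longrightarrow> ip f f = 0 \<longleftrightarrow> (\<forall>x\<in>X. f x = 0)"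
    and complete:
      "(\<And>n. F n \<in> H) \<Longrightarrow>
       (\<And>e. 0 < e \<Longrightarrow> \<exists>N. \<forall>m\<ge>N. \<forall>n\<ge>N.
          sqrt (Re (ip (\<lambda>x. F m x - F n x) (\<lambda>x. F m x - F n x))) < e) \<Longrightarrow>
       \<exists>f\<in>H. (\<lambda>n. sqrt (Re (ip (\<lambda>x. F n x - f x) (\<lambda>x. F n x - f x)))) \<longlonglongrightarrow> 0"
    and kernel_mem: "w \<in> X \<Longrightarrow> (\<lambda>z. K z w) \<in> H"
    and reproducing: "f \<in> H \<Longrightarrow> w \<in> X \<Longrightarrow> ip f (\<lambda>z. K z w) = f w"

definition ip_norm :: "(('a \<Rightarrow> complex) \<Rightarrow> ('a \<Rightarrow> complex) \<Rightarrow> complex) \<Rightarrow> ('a \<Rightarrow> complex) \<Rightarrow> real" where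
  "ip_norm ip f = sqrt (Re (ip f f))"

definition de_branges_rovnyak_kernel :: "(complex \<Rightarrow> complex) \<Rightarrow> complex \<Rightarrow> complex \<Rightarrow> complex" where
  "de_branges_rovnyak_kernel b z w = (1 - cnj (b w) * b z) / (1 - cnj w * z)"

definition is_de_branges_rovnyak_space ::
  "(complex \<Rightarrow> complex) \<Rightarrow> (complex \<Rightarrow> complex) set \<Rightarrow>
   ((complex \<Rightarrow> complex) \<Rightarrow> (complex \<Rightarrow> complex) \<Rightarrow> complex) \<Rightarrow> bool" where
  "is_de_branges_rovnyak_space b H ip \<longleftrightarrow>
     reproducing_kernel_hilbert_space (ball 0 1) (de_branges_rovnyak_kernel b) H ip"

end

theory Submission
  imports Defs
begin

text \<open>Let \<open>T\<close> be the co-analytic Toeplitz operator with symbol conjugate to \<open>\<phi>\<close>, acting on Taylor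
  coefficients. The functions \<open>f\<close> in \<open>H\<^sup>2\<close> with \<open>T f\<close> square-summable, normed by
  \<open>\<parallel>f\<parallel>\<^sup>2 + \<parallel>T f\<parallel>\<^sup>2\<close>, form a Hilbert space because \<open>T\<close> is closed. Its reproducing kernel is that of
  \<open>\<H>(b)\<close>, so the two spaces coincide. To see this, write \<open>k\<^sub>w\<close> for the Szego kernel. The relation
  \<open>|b|\<^sup>2 + |a|\<^sup>2 = 1\<close> says that \<open>u \<mapsto> (b u, a u)\<close> is isometric on \<open>H\<^sup>2\<close>; applied to \<open>k\<^sub>w\<close> and \<open>z\<^sup>m / a\<close>
  it gives \<open>T (b k\<^sub>w) = cnj (1 / a w) k\<^sub>w - a k\<^sub>w\<close>, hence \<open>T K\<^sub>w = cnj (b w) a k\<^sub>w\<close> for the kernel \<open>K\<^sub>w\<close>.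
  The reproducing property then reduces to \<open>\<langle>T f, a k\<^sub>w\<rangle> = \<langle>f, \<phi> a k\<^sub>w\<rangle> = \<langle>f, b k\<^sub>w\<rangle>\<close>.
  That \<open>1 / a\<close> is in \<open>H\<^sup>2\<close> is where outerness enters: truncating the weight of \<open>a\<close> from below gives
  bounded functions \<open>G\<^sub>n \<longlonglongrightarrow> 1 / a\<close> in modulus with \<open>|G\<^sub>n| \<le> 1 / |a|\<close>, and the isometry bounds
  \<open>\<parallel>G\<^sub>n\<parallel>\<^sup>2 = \<parallel>b G\<^sub>n\<parallel>\<^sup>2 + \<parallel>a G\<^sub>n\<parallel>\<^sup>2\<close> by \<open>\<parallel>\<phi>\<parallel>\<^sup>2 + 1\<close>.\<close>

section \<open>Square-summable sequences\<close>

definition square_summable :: "(nat \<Rightarrow> complex) \<Rightarrow> bool" where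
  "square_summable x \<longleftrightarrow> summable (\<lambda>n. (cmod (x n))\<^sup>2)"

definition l2_inner :: "(nat \<Rightarrow> complex) \<Rightarrow> (nat \<Rightarrow> complex) \<Rightarrow> complex" where
  "l2_inner x y = (\<Sum>n. x n * cnj (y n))"

definition l2_norm :: "(nat \<Rightarrow> complex) \<Rightarrow> real" where
  "l2_norm x = sqrt (\<Sum>n. (cmod (x n))\<^sup>2)"

lemma square_summable_scale: "square_summable x \<Longrightarrow> square_summable (\<lambda>n. c * x n)"
  by (simp add: square_summable_def norm_mult power_mult_distrib summable_mult)

lemma square_summable_zero [simp]: "square_summable (\<lambda>_. 0)"
  by (simp add: square_summable_def)

lemma square_summable_add:
  assumes "square_summable x" "square_summable y"
  shows "square_summable (\<lambda>n. x n + y n)"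
  unfolding square_summable_def
proof (rule summable_comparison_test')
  show "summable (\<lambda>n. 2 * (cmod (x n))\<^sup>2 + 2 * (cmod (y n))\<^sup>2)"
    using assms by (intro summable_add summable_mult) (auto simp: square_summable_def)
  fix n :: nat assume "n \<ge> 0"
  have "(cmod (x n + y n))\<^sup>2 \<le> (cmod (x n) + cmod (y n))\<^sup>2"
    by (intro power_mono norm_triangle_ineq) auto
  also have "\<dots> \<le> 2 * (cmod (x n))\<^sup>2 + 2 * (cmod (y n))\<^sup>2"
    using sum_squares_bound[of "cmod (x n)" "cmod (y n)"] by (simp add: power2_sum)
  finally show "norm ((cmod (x n + y n))\<^sup>2) \<le> 2 * (cmod (x n))\<^sup>2 + 2 * (cmod (y n))\<^sup>2"
    by simp
qed

lemma square_summable_diff: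
  assumes "square_summable x" "square_summable y"
  shows "square_summable (\<lambda>n. x n - y n)"
  using square_summable_add[OF assms(1) square_summable_scale[OF assms(2), of "-1"]] by simp

lemma square_summable_shift: "square_summable (\<lambda>n. x (m + n)) \<longleftrightarrow> square_summable x"
  unfolding square_summable_def
  using summable_iff_shift[of "\<lambda>n. (cmod (x n))\<^sup>2" m] by (simp add: add.commute)

lemma summable_norm_mult:
  assumes "square_summable x" "square_summable y"
  shows "summable (\<lambda>n. cmod (x n) * cmod (y n))"
proof (rule summable_comparison_test')
  show "summable (\<lambda>n. (cmod (x n))\<^sup>2 + (cmod (y n))\<^sup>2)"
    using assms by (intro summable_add) (auto simp: square_summable_def)
  fix n :: nat assume "n \<ge> 0"
  have "2 * (cmod (x n) * cmod (y n)) \<le> (cmod (x n))\<^sup>2 + (cmod (y n))\<^sup>2"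
    using sum_squares_bound[of "cmod (x n)" "cmod (y n)"] by simp
  moreover have "0 \<le> cmod (x n) * cmod (y n)" by simp
  ultimately show "norm (cmod (x n) * cmod (y n)) \<le> (cmod (x n))\<^sup>2 + (cmod (y n))\<^sup>2"
    unfolding real_norm_def by linarith
qed

lemma summable_l2_inner:
  assumes "square_summable x" "square_summable y"
  shows "summable (\<lambda>n. x n * cnj (y n))"
  by (rule summable_norm_cancel) (simp add: norm_mult summable_norm_mult[OF assms])

lemma l2_inner_sums:
  assumes "square_summable x" "square_summable y"
  shows "(\<lambda>n. x n * cnj (y n)) sums l2_inner x y"
  unfolding l2_inner_def using summable_l2_inner[OF assms] by (rule summable_sums)

lemma suminf_square_nonneg [simp]:
  "square_summable x \<Longrightarrow> 0 \<le> (\<Sum>n. (cmod (x n))\<^sup>2)"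
  by (simp add: square_summable_def suminf_nonneg)

lemma l2_norm_nonneg [simp]: "square_summable x \<Longrightarrow> 0 \<le> l2_norm x"
  by (simp add: l2_norm_def)

lemma l2_norm_square: "square_summable x \<Longrightarrow> (l2_norm x)\<^sup>2 = (\<Sum>n. (cmod (x n))\<^sup>2)"
  by (simp add: l2_norm_def)

lemma l2_inner_self: "square_summable x \<Longrightarrow> l2_inner x x = of_real ((l2_norm x)\<^sup>2)"
  by (simp add: l2_norm_square l2_inner_def complex_norm_square[symmetric] suminf_of_real[symmetric] square_summable_def del: of_real_power)

lemma l2_norm_power2_sums:
  "square_summable x \<Longrightarrow> (\<lambda>n. (cmod (x n))\<^sup>2) sums (l2_norm x)\<^sup>2"
  by (simp add: l2_norm_square square_summable_def summable_sums)

lemma sum_le_l2_norm: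
  "square_summable x \<Longrightarrow> finite I \<Longrightarrow> (\<Sum>n\<in>I. (cmod (x n))\<^sup>2) \<le> (l2_norm x)\<^sup>2"
  by (simp add: l2_norm_square square_summable_def sum_le_suminf)

lemma component_le_l2_norm: "square_summable x \<Longrightarrow> cmod (x n) \<le> l2_norm x"
  by (rule power2_le_imp_le) (use sum_le_l2_norm[of x "{n}"] in simp_all)

text \<open>Limits are known only coordinatewise at first, so norm bounds reach them through finite
  partial sums; square-summability and the norm estimate then come out together.\<close>

lemma l2_norm_bound:
  assumes "0 \<le> C" "\<And>N. (\<Sum>n<N. (cmod (x n))\<^sup>2) \<le> C\<^sup>2"
  shows "square_summable x" "l2_norm x \<le> C"
proof -
  show *: "square_summable x"
    unfolding square_summable_def by (rule summableI_nonneg_bounded) (use assms(2) in auto)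
  have "(\<Sum>n. (cmod (x n))\<^sup>2) \<le> C\<^sup>2"
    using * assms(2) unfolding square_summable_def by (intro suminf_le_const)
  then show "l2_norm x \<le> C"
    using assms(1) by (simp add: l2_norm_def real_le_lsqrt)
qed

lemma suminf_norm_mult_le:
  assumes "square_summable x" "square_summable y"
  shows "(\<Sum>n. cmod (x n) * cmod (y n)) \<le> l2_norm x * l2_norm y"
proof (rule suminf_le_const[OF summable_norm_mult[OF assms]])
  fix N
  have L: "L2_set (\<lambda>n. cmod (z n)) {..<N} \<le> l2_norm z" if "square_summable z" for z :: "nat \<Rightarrow> complex"
    using sum_le_l2_norm[OF that, of "{..<N}"] that by (simp add: L2_set_def real_le_lsqrt)
  have "(\<Sum>n<N. cmod (x n) * cmod (y n)) \<le> L2_set (\<lambda>n. cmod (x n)) {..<N} * L2_set (\<lambda>n. cmod (y n)) {..<N}"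
    using L2_set_mult_ineq[of "\<lambda>n. cmod (x n)" "\<lambda>n. cmod (y n)" "{..<N}"] by simp
  also have "\<dots> \<le> l2_norm x * l2_norm y"
    using assms by (intro mult_mono L L2_set_nonneg) auto
  finally show "(\<Sum>n<N. cmod (x n) * cmod (y n)) \<le> l2_norm x * l2_norm y" .
qed

lemma l2_Cauchy_Schwarz:
  assumes "square_summable x" "square_summable y"
  shows "cmod (l2_inner x y) \<le> l2_norm x * l2_norm y"
proof -
  have "cmod (l2_inner x y) \<le> (\<Sum>n. cmod (x n * cnj (y n)))"
    unfolding l2_inner_def by (rule summable_norm) (simp add: norm_mult summable_norm_mult[OF assms])
  also have "\<dots> \<le> l2_norm x * l2_norm y"
    using suminf_norm_mult_le[OF assms] by (simp add: norm_mult)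
  finally show ?thesis .
qed

lemma l2_inner_add_left:
  assumes "square_summable x" "square_summable y" "square_summable z"
  shows "l2_inner (\<lambda>n. x n + y n) z = l2_inner x z + l2_inner y z"
  using suminf_add[OF summable_l2_inner[OF assms(1,3)] summable_l2_inner[OF assms(2,3)]]
  by (simp add: l2_inner_def distrib_right)

lemma l2_inner_scale_left:
  assumes "square_summable x" "square_summable y"
  shows "l2_inner (\<lambda>n. c * x n) y = c * l2_inner x y"
  using suminf_mult[OF summable_l2_inner[OF assms], of c] by (simp add: l2_inner_def mult.assoc)

lemma l2_inner_commute:
  assumes "square_summable x" "square_summable y"
  shows "l2_inner x y = cnj (l2_inner y x)"
proof -
  have "(\<lambda>n. cnj (y n * cnj (x n))) sums cnj (l2_inner y x)"
    using l2_inner_sums[OF assms(2,1)] by (subst sums_cnj)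
  then show ?thesis
    using sums_unique by (force simp: l2_inner_def mult.commute)
qed

lemma l2_inner_diff_left:
  assumes "square_summable x" "square_summable y" "square_summable z"
  shows "l2_inner (\<lambda>n. x n - y n) z = l2_inner x z - l2_inner y z"
  using suminf_diff[OF summable_l2_inner[OF assms(1,3)] summable_l2_inner[OF assms(2,3)]]
  by (simp add: l2_inner_def left_diff_distrib)

lemma l2_inner_diff_right:
  assumes "square_summable x" "square_summable y" "square_summable z"
  shows "l2_inner z (\<lambda>n. x n - y n) = l2_inner z x - l2_inner z y"
  using suminf_diff[OF summable_l2_inner[OF assms(3,1)] summable_l2_inner[OF assms(3,2)]]
  by (simp add: l2_inner_def right_diff_distrib)

lemma l2_inner_scale_right:
  assumes "square_summable x" "square_summable y"
  shows "l2_inner x (\<lambda>n. c * y n) = cnj c * l2_inner x y"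
  using suminf_mult[OF summable_l2_inner[OF assms], of "cnj c"] by (simp add: l2_inner_def mult_ac)

lemma l2_inner_tendsto:
  assumes "\<And>k. square_summable (x k)" "square_summable y" "square_summable z"
    and "(\<lambda>k. l2_norm (\<lambda>n. x k n - y n)) \<longlonglongrightarrow> 0"
  shows "(\<lambda>k. l2_inner (x k) z) \<longlonglongrightarrow> l2_inner y z"
proof (rule LIM_zero_cancel, rule Lim_null_comparison)
  show "\<forall>\<^sub>F k in sequentially. norm (l2_inner (x k) z - l2_inner y z)
      \<le> l2_norm (\<lambda>n. x k n - y n) * l2_norm z"
    using l2_Cauchy_Schwarz[OF square_summable_diff[OF assms(1,2)] assms(3)]
    by (simp add: l2_inner_diff_left[OF assms(1-3)])
  show "(\<lambda>k. l2_norm (\<lambda>n. x k n - y n) * l2_norm z) \<longlonglongrightarrow> 0"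
    using tendsto_mult_left_zero[OF assms(4)] .
qed

section \<open>Completeness and weak convergence of sequences\<close>

text \<open>Each coordinate is dominated by the norm, so coordinatewise limits exist; the Cauchy
  estimate survives the passage to the limit on finite partial sums.\<close>

lemma l2_complete:
  assumes sq: "\<And>k. square_summable (x k)"
    and Cauchy: "\<And>e. 0 < e \<Longrightarrow> \<exists>N. \<forall>m\<ge>N. \<forall>k\<ge>N. l2_norm (\<lambda>n. x m n - x k n) < e"
  obtains y where "square_summable y" "(\<lambda>k. l2_norm (\<lambda>n. x k n - y n)) \<longlonglongrightarrow> 0"
proof -
  have "convergent (\<lambda>k. x k n)" for n
    unfolding Cauchy_convergent_iff[symmetric]
  proof (rule CauchyI)
    fix e :: real assume "0 < e"
    then obtain N where N: "\<forall>m\<ge>N. \<forall>k\<ge>N. l2_norm (\<lambda>n. x m n - x k n) < e"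
      using Cauchy by blast
    show "\<exists>N. \<forall>m\<ge>N. \<forall>k\<ge>N. norm (x m n - x k n) < e"
      using N component_le_l2_norm[OF square_summable_diff[OF sq sq]]
      by (meson le_less_trans)
  qed
  then obtain y where y: "(\<lambda>k. x k n) \<longlonglongrightarrow> y n" for n
    unfolding convergent_def by metis
  \<comment> \<open>Keep \<open>k\<close> fixed and let the other index tend to infinity in each
    finite partial sum. This gives square-summability of \<open>x k - y\<close> along with the
    bound, before anything is known about \<open>y\<close> itself.\<close>
  have close: "square_summable (\<lambda>n. x k n - y n) \<and> l2_norm (\<lambda>n. x k n - y n) \<le> e"
    if "0 < e" "\<forall>m\<ge>N. \<forall>k\<ge>N. l2_norm (\<lambda>n. x m n - x k n) < e" "k \<ge> N" for e N k
  proof -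
    have "(\<Sum>n<M. (cmod (x k n - y n))\<^sup>2) \<le> e\<^sup>2" for M
    proof (rule tendsto_upperbound[OF _ _ trivial_limit_sequentially])
      show "(\<lambda>m. \<Sum>n<M. (cmod (x k n - x m n))\<^sup>2) \<longlonglongrightarrow> (\<Sum>n<M. (cmod (x k n - y n))\<^sup>2)"
        by (intro tendsto_intros y)
      show "\<forall>\<^sub>F m in sequentially. (\<Sum>n<M. (cmod (x k n - x m n))\<^sup>2) \<le> e\<^sup>2"
        using eventually_ge_at_top[of N]
      proof eventually_elim
        case (elim m)
        have "(\<Sum>n<M. (cmod (x k n - x m n))\<^sup>2) \<le> (l2_norm (\<lambda>n. x k n - x m n))\<^sup>2"
          by (intro sum_le_l2_norm square_summable_diff sq) auto
        also have "\<dots> \<le> e\<^sup>2"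
          using that elim by (intro power_mono less_imp_le l2_norm_nonneg square_summable_diff sq) auto
        finally show ?case .
      qed
    qed
    with that show ?thesis
      using l2_norm_bound[of e "\<lambda>n. x k n - y n"] by auto
  qed
  obtain N where "\<forall>m\<ge>N. \<forall>k\<ge>N. l2_norm (\<lambda>n. x m n - x k n) < 1"
    using Cauchy[of 1] by auto
  then have "square_summable (\<lambda>n. x N n - y n)"
    using close[of 1 N N] by auto
  then have y2: "square_summable y"
    using square_summable_diff[OF sq[of N], of "\<lambda>n. x N n - y n"] by simp
  have "(\<lambda>k. l2_norm (\<lambda>n. x k n - y n)) \<longlonglongrightarrow> 0"
  proof (rule LIMSEQ_I)
    fix r :: real assume "0 < r"
    then obtain N where N: "\<forall>m\<ge>N. \<forall>k\<ge>N. l2_norm (\<lambda>n. x m n - x k n) < r / 2"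
      using Cauchy[of "r/2"] by auto
    show "\<exists>no. \<forall>n\<ge>no. norm (l2_norm (\<lambda>i. x n i - y i) - 0) < r"
      using close[of "r/2" N] \<open>0 < r\<close> N l2_norm_nonneg[OF square_summable_diff[OF sq y2]]
      by (intro exI[of _ N]) force
  qed
  with y2 show thesis by (rule that)
qed

text \<open>Far out, the small tail of \<open>y\<close> meets differences of bounded norm and
  contributes little; the finitely many remaining terms converge one by one.\<close>

lemma l2_weak_tendsto:
  assumes y: "square_summable y" and x: "\<And>k. square_summable (x k)" "square_summable z"
    and bounded: "\<And>k. l2_norm (x k) \<le> C"
    and coeff: "\<And>n. (\<lambda>k. x k n) \<longlonglongrightarrow> z n"
  shows "(\<lambda>k. l2_inner y (x k)) \<longlonglongrightarrow> l2_inner y z"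
proof -
  define w where "w k = (\<lambda>n. x k n - z n)" for k
  have w: "square_summable (w k)" for k
    unfolding w_def by (intro square_summable_diff x)
  obtain D where D: "\<And>k. (l2_norm (w k))\<^sup>2 \<le> D"
  proof
    fix k
    have "(\<Sum>n. (cmod (w k n))\<^sup>2) \<le> (\<Sum>n. 2 * (cmod (x k n))\<^sup>2 + 2 * (cmod (z n))\<^sup>2)"
    proof (rule suminf_le)
      fix n
      have "(cmod (w k n))\<^sup>2 \<le> (cmod (x k n) + cmod (z n))\<^sup>2"
        unfolding w_def by (intro power_mono norm_triangle_ineq4) auto
      also have "\<dots> \<le> 2 * (cmod (x k n))\<^sup>2 + 2 * (cmod (z n))\<^sup>2"
        using sum_squares_bound[of "cmod (x k n)" "cmod (z n)"] by (simp add: power2_sum)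
      finally show "(cmod (w k n))\<^sup>2 \<le> 2 * (cmod (x k n))\<^sup>2 + 2 * (cmod (z n))\<^sup>2" .
    qed (use w x in \<open>auto simp: square_summable_def intro!: summable_add summable_mult\<close>)
    also have "\<dots> = 2 * (l2_norm (x k))\<^sup>2 + 2 * (l2_norm z)\<^sup>2"
      using x by (intro sums_unique[symmetric] sums_add sums_mult l2_norm_power2_sums)
    also have "\<dots> \<le> 2 * C\<^sup>2 + 2 * (l2_norm z)\<^sup>2"
      using bounded[of k] x by (auto intro!: power_mono)
    finally show "(l2_norm (w k))\<^sup>2 \<le> 2 * C\<^sup>2 + 2 * (l2_norm z)\<^sup>2"
      using w by (simp add: l2_norm_square)
  qed
  then have D0: "0 \<le> D" by (rule order_trans[OF zero_le_power2])
  have "(\<lambda>k. l2_inner y (w k)) \<longlonglongrightarrow> 0"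
  proof (rule LIMSEQ_I)
    fix r :: real assume r: "0 < r"
    \<comment> \<open>\<open>D\<close> bounds the squared norm of \<open>w k\<close>, so
      \<open>D + 1\<close> bounds the norm of its tails, because \<open>D \<le> (D + 1)\<close>
      squared. With this \<open>s\<close> the tails contribute at most
      \<open>s * (D + 1) = r / 2\<close>.\<close>
    define s where "s = r / (2 * (D + 1))"
    have s: "0 < s" using r D0 by (simp add: s_def)
    have "summable (\<lambda>n. (cmod (y n))\<^sup>2)" using y by (simp add: square_summable_def)
    from suminf_exist_split[OF _ this, of "s\<^sup>2"] s obtain N where
      N: "norm (\<Sum>n. (cmod (y (n + N)))\<^sup>2) < s\<^sup>2"
      by auto
    have tail: "square_summable (\<lambda>n. y (n + N))" "square_summable (\<lambda>n. w k (n + N))" for k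
      using square_summable_shift[of y N] square_summable_shift[of "w k" N] y w
      by (simp_all add: add.commute)
    have ytail: "l2_norm (\<lambda>n. y (n + N)) \<le> s"
      using N s by (simp add: l2_norm_def real_le_lsqrt)
    have wtail: "l2_norm (\<lambda>n. w k (n + N)) \<le> D + 1" for k
    proof -
      have "(l2_norm (\<lambda>n. w k (n + N)))\<^sup>2 \<le> (l2_norm (w k))\<^sup>2"
      proof -
        have "summable (\<lambda>n. (cmod (w k n))\<^sup>2)" using w by (simp add: square_summable_def)
        from suminf_split_initial_segment[OF this, of N]
        have "(l2_norm (w k))\<^sup>2 = (l2_norm (\<lambda>n. w k (n + N)))\<^sup>2 + (\<Sum>n<N. (cmod (w k n))\<^sup>2)"
          unfolding l2_norm_square[OF w] l2_norm_square[OF tail(2)] .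
        then show ?thesis using sum_nonneg[of "{..<N}" "\<lambda>n. (cmod (w k n))\<^sup>2"] by simp
      qed
      also have "\<dots> \<le> D" by (rule D)
      also have "\<dots> \<le> (D + 1)\<^sup>2" using D0 by (simp add: power2_sum)
      finally show ?thesis by (rule power2_le_imp_le) (use D0 in auto)
    qed
    have "(\<lambda>k. \<Sum>n<N. y n * cnj (w k n)) \<longlonglongrightarrow> (\<Sum>n<N. y n * cnj 0)"
      unfolding w_def by (intro tendsto_intros) (use LIM_zero[OF coeff] in auto)
    then obtain K where K: "\<And>k. k \<ge> K \<Longrightarrow> cmod (\<Sum>n<N. y n * cnj (w k n)) < r / 2"
      using LIMSEQ_D[of "\<lambda>k. \<Sum>n<N. y n * cnj (w k n)" 0 "r/2"] r by auto
    have "cmod (l2_inner y (w k)) < r" if "k \<ge> K" for k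
    proof -
      have "l2_inner y (w k) = l2_inner (\<lambda>n. y (n + N)) (\<lambda>n. w k (n + N)) + (\<Sum>n<N. y n * cnj (w k n))"
        unfolding l2_inner_def by (rule suminf_split_initial_segment[OF summable_l2_inner[OF y w]])
      then have "cmod (l2_inner y (w k)) \<le> cmod (l2_inner (\<lambda>n. y (n + N)) (\<lambda>n. w k (n + N))) + cmod (\<Sum>n<N. y n * cnj (w k n))"
        by (simp add: norm_triangle_ineq)
      also have "cmod (l2_inner (\<lambda>n. y (n + N)) (\<lambda>n. w k (n + N))) \<le> s * (D + 1)"
        using l2_Cauchy_Schwarz[OF tail(1) tail(2)[of k]]
          mult_mono[OF ytail wtail[of k]] s l2_norm_nonneg[OF tail(2)[of k]]
        by linarith
      also have "s * (D + 1) = r / 2" using D0 by (simp add: s_def field_simps)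
      finally show ?thesis using K[OF that] by linarith
    qed
    then show "\<exists>no. \<forall>n\<ge>no. norm (l2_inner y (w n) - 0) < r" by auto
  qed
  then have "(\<lambda>k. l2_inner y (x k) - l2_inner y z) \<longlonglongrightarrow> 0"
    using l2_inner_diff_right[OF x y] by (simp add: w_def)
  then show ?thesis by (rule LIM_zero_cancel)
qed

section \<open>Uniqueness of reproducing kernel Hilbert spaces\<close>

text \<open>Finite linear combinations of kernel functions, generated one term at a time so that
  linearity of the inner product applies by induction; repeated points are harmless.\<close>

inductive_set kernel_span :: "'a set \<Rightarrow> ('a \<Rightarrow> 'a \<Rightarrow> complex) \<Rightarrow> ('a \<Rightarrow> complex) set"
  for X :: "'a set" and K :: "'a \<Rightarrow> 'a \<Rightarrow> complex" where
  zero: "(\<lambda>_. 0) \<in> kernel_span X K"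
| step: "s \<in> kernel_span X K \<Longrightarrow> w \<in> X \<Longrightarrow> (\<lambda>z. c * K z w + s z) \<in> kernel_span X K"

lemma kernel_span_scale:
  "s \<in> kernel_span X K \<Longrightarrow> (\<lambda>z. d * s z) \<in> kernel_span X K"
proof (induction rule: kernel_span.induct)
  case zero
  then show ?case by (simp add: kernel_span.zero)
next
  case (step s w c)
  from kernel_span.step[OF step.IH step.hyps(2), of "d * c"]
  show ?case by (simp add: algebra_simps)
qed

lemma kernel_span_add:
  "s \<in> kernel_span X K \<Longrightarrow> t \<in> kernel_span X K \<Longrightarrow> (\<lambda>z. s z + t z) \<in> kernel_span X K"
proof (induction rule: kernel_span.induct)
  case zero
  then show ?case by simp
next
  case (step s w c)
  from kernel_span.step[OF step.IH[OF step.prems] step.hyps(2), of c]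
  show ?case by (simp add: algebra_simps)
qed

section \<open>Geometry of an abstract reproducing kernel Hilbert space\<close>

context reproducing_kernel_hilbert_space
begin

lemma diff_mem: "f \<in> H \<Longrightarrow> g \<in> H \<Longrightarrow> (\<lambda>x. f x - g x) \<in> H"
  using add_mem[of f "\<lambda>x. - 1 * g x"] scale_mem[of g "-1"] by simp

lemma ip_diff_left:
  assumes "f \<in> H" "g \<in> H" "h \<in> H"
  shows "ip (\<lambda>x. f x - g x) h = ip f h - ip g h"
proof -
  have "ip (\<lambda>x. f x - g x) h = ip (\<lambda>x. f x + (-1) * g x) h" by simp
  also have "\<dots> = ip f h + ip (\<lambda>x. (-1) * g x) h"
    by (rule ip_add_left[OF assms(1) scale_mem[OF assms(2)] assms(3)])
  also have "\<dots> = ip f h - ip g h"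
    unfolding ip_scale_left[OF assms(2,3)] by simp
  finally show ?thesis .
qed

lemma ip_add_right:
  assumes "f \<in> H" "g \<in> H" "h \<in> H"
  shows "ip h (\<lambda>x. f x + g x) = ip h f + ip h g"
  unfolding ip_commute[OF assms(3) add_mem[OF assms(1,2)]] ip_add_left[OF assms]
    ip_commute[OF assms(3,1)] ip_commute[OF assms(3,2)] by simp

lemma ip_scale_right:
  assumes "f \<in> H" "h \<in> H"
  shows "ip h (\<lambda>x. c * f x) = cnj c * ip h f"
  unfolding ip_commute[OF assms(2) scale_mem[OF assms(1)]] ip_scale_left[OF assms]
    ip_commute[OF assms(2,1)] by simp

lemma ip_diff_right:
  assumes "f \<in> H" "g \<in> H" "h \<in> H"
  shows "ip h (\<lambda>x. f x - g x) = ip h f - ip h g"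
  unfolding ip_commute[OF assms(3) diff_mem[OF assms(1,2)]] ip_diff_left[OF assms]
    ip_commute[OF assms(3,1)] ip_commute[OF assms(3,2)] by simp

lemma ip_norm_square: "f \<in> H \<Longrightarrow> (ip_norm ip f)\<^sup>2 = Re (ip f f)"
  by (simp add: ip_norm_def ip_nonneg)

lemma ip_norm_nonneg [simp]: "f \<in> H \<Longrightarrow> 0 \<le> ip_norm ip f"
  by (simp add: ip_norm_def ip_nonneg)

text \<open>This single expansion feeds the Cauchy-Schwarz and triangle inequalities, the
  parallelogram law and the variational argument for density.\<close>

lemma ip_norm_diff_scale_square:
  assumes "f \<in> H" "g \<in> H"
  shows "(ip_norm ip (\<lambda>x. f x - c * g x))\<^sup>2 =
    (ip_norm ip f)\<^sup>2 - 2 * Re (cnj c * ip f g) + (cmod c)\<^sup>2 * (ip_norm ip g)\<^sup>2"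
proof -
  have cg: "(\<lambda>x. c * g x) \<in> H" using assms by (intro scale_mem)
  have "ip (\<lambda>x. f x - c * g x) (\<lambda>x. f x - c * g x) =
      ip f f - cnj c * ip f g - (c * ip g f - c * (cnj c * ip g g))"
    using assms cg by (simp add: ip_diff_left ip_diff_right diff_mem ip_scale_left ip_scale_right right_diff_distrib)
  moreover have "c * (cnj c * ip g g) = of_real ((cmod c)\<^sup>2) * ip g g"
    unfolding complex_norm_square by (simp only: mult.assoc)
  moreover have "c * ip g f = cnj (cnj c * ip f g)"
    unfolding ip_commute[OF assms(2,1)] by simp
  ultimately show ?thesis
    using assms cg by (simp add: ip_norm_square diff_mem)
qed

text \<open>For real \<open>s\<close> the squared norm of \<open>f - s * ip f g * g\<close> is a
  nonnegative quadratic in \<open>s\<close>, and suitable values of \<open>s\<close> give the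
  inequality.\<close>

lemma Cauchy_Schwarz:
  assumes "f \<in> H" "g \<in> H"
  shows "cmod (ip f g) \<le> ip_norm ip f * ip_norm ip g"
proof -
  define A B c where "A = (ip_norm ip f)\<^sup>2" and "B = (ip_norm ip g)\<^sup>2" and "c = (cmod (ip f g))\<^sup>2"
  have *: "0 \<le> A - 2 * s * c + s\<^sup>2 * c * B" for s :: real
  proof -
    have "0 \<le> (ip_norm ip (\<lambda>x. f x - (of_real s * ip f g) * g x))\<^sup>2" by simp
    also have "\<dots> = A - 2 * Re (cnj (of_real s * ip f g) * ip f g) + (cmod (of_real s * ip f g))\<^sup>2 * B"
      unfolding A_def B_def by (rule ip_norm_diff_scale_square[OF assms])
    also have "cnj (of_real s * ip f g) * ip f g = of_real (s * c)"
      using complex_norm_square[of "ip f g"] by (simp add: c_def mult.commute)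
    finally show ?thesis by (simp add: c_def norm_mult power_mult_distrib)
  qed
  have "c \<le> A * B"
  proof (cases "B = 0")
    case True
    have "c = 0"
    proof (rule ccontr)
      assume "c \<noteq> 0"
      \<comment> \<open>With \<open>B = 0\<close> the quadratic is only linear in \<open>s\<close>;
        this value of \<open>s\<close> would make it equal to \<open>-1\<close>.\<close>
      then have "2 * ((A + 1) / (2 * c)) * c = A + 1" by simp
      then show False using *[of "(A + 1) / (2 * c)"] True by simp
    qed
    then show ?thesis using True by simp
  next
    case False
    then have "B > 0" by (simp add: B_def)
    \<comment> \<open>\<open>s = 1 / B\<close> is the minimizer, where the quadratic equals
      \<open>A - c / B\<close>.\<close>
    then show ?thesis
      using *[of "1 / B"] by (simp add: field_simps power2_eq_square)
  qed
  then have "(cmod (ip f g))\<^sup>2 \<le> (ip_norm ip f * ip_norm ip g)\<^sup>2"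
    by (simp add: A_def B_def c_def power_mult_distrib)
  then show ?thesis
    by (rule power2_le_imp_le) (simp add: assms)
qed

lemma ip_norm_triangle:
  assumes "f \<in> H" "g \<in> H"
  shows "ip_norm ip f \<le> ip_norm ip g + ip_norm ip (\<lambda>x. f x - g x)"
proof -
  have h: "(\<lambda>x. f x - g x) \<in> H" using assms by (rule diff_mem)
  define h where "h = (\<lambda>x. f x - g x)"
  have hH: "h \<in> H" using h by (simp add: h_def)
  have "(ip_norm ip (\<lambda>x. g x - (-1) * h x))\<^sup>2 \<le> (ip_norm ip g + ip_norm ip h)\<^sup>2"
    using Cauchy_Schwarz[OF assms(2) hH] complex_Re_le_cmod[of "ip g h"]
    unfolding ip_norm_diff_scale_square[OF assms(2) hH] power2_sum by simp
  then have "(ip_norm ip f)\<^sup>2 \<le> (ip_norm ip g + ip_norm ip h)\<^sup>2"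
    by (simp add: h_def)
  then show ?thesis unfolding h_def
    by (rule power2_le_imp_le) (use assms h in simp)
qed

lemma ip_norm_diff_commute:
  assumes "f \<in> H" "g \<in> H"
  shows "ip_norm ip (\<lambda>x. f x - g x) = ip_norm ip (\<lambda>x. g x - f x)"
proof -
  have "ip (\<lambda>x. f x - g x) (\<lambda>x. f x - g x) = ip (\<lambda>x. g x - f x) (\<lambda>x. g x - f x)"
    using assms by (simp add: ip_diff_left ip_diff_right diff_mem)
  then show ?thesis by (simp add: ip_norm_def)
qed

text \<open>The functions may differ off \<open>X\<close>, so they need not be equal. Their
  difference has norm zero by \<open>ip_eq_0_iff\<close>, and the triangle inequality in both
  directions finishes.\<close>

lemma ip_norm_cong:
  assumes "f \<in> H" "g \<in> H" "\<And>x. x \<in> X \<Longrightarrow> f x = g x"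
  shows "ip_norm ip f = ip_norm ip g"
proof -
  have "ip (\<lambda>x. f x - g x) (\<lambda>x. f x - g x) = 0" "ip (\<lambda>x. g x - f x) (\<lambda>x. g x - f x) = 0"
    using assms diff_mem by (simp_all add: ip_eq_0_iff)
  then have "ip_norm ip (\<lambda>x. f x - g x) = 0" "ip_norm ip (\<lambda>x. g x - f x) = 0"
    by (simp_all add: ip_norm_def)
  then show ?thesis
    using ip_norm_triangle[OF assms(1,2)] ip_norm_triangle[OF assms(2,1)] by simp
qed

lemma ip_norm_tendsto:
  assumes "\<And>n. F n \<in> H" "f \<in> H" "(\<lambda>n. ip_norm ip (\<lambda>x. F n x - f x)) \<longlonglongrightarrow> 0"
  shows "(\<lambda>n. ip_norm ip (F n)) \<longlonglongrightarrow> ip_norm ip f"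
proof (rule LIM_zero_cancel, rule Lim_null_comparison[OF _ assms(3)])
  show "\<forall>\<^sub>F n in sequentially. norm (ip_norm ip (F n) - ip_norm ip f) \<le> ip_norm ip (\<lambda>x. F n x - f x)"
  proof (intro always_eventually allI)
    fix n
    show "norm (ip_norm ip (F n) - ip_norm ip f) \<le> ip_norm ip (\<lambda>x. F n x - f x)"
      using ip_norm_triangle[OF assms(1)[of n] assms(2)] ip_norm_triangle[OF assms(2) assms(1)[of n]]
        ip_norm_diff_commute[OF assms(1)[of n] assms(2)] by simp
  qed
qed

text \<open>Evaluation at \<open>w\<close> is the inner product with a kernel function, hence
  continuous by Cauchy-Schwarz.\<close>

lemma eval_tendsto:
  assumes "\<And>n. F n \<in> H" "f \<in> H" "(\<lambda>n. ip_norm ip (\<lambda>x. F n x - f x)) \<longlonglongrightarrow> 0" "w \<in> X"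
  shows "(\<lambda>n. F n w) \<longlonglongrightarrow> f w"
proof (rule LIM_zero_cancel, rule Lim_null_comparison)
  show "(\<lambda>n. ip_norm ip (\<lambda>x. F n x - f x) * ip_norm ip (\<lambda>z. K z w)) \<longlonglongrightarrow> 0"
    using tendsto_mult_left_zero[OF assms(3)] .
  show "\<forall>\<^sub>F n in sequentially. norm (F n w - f w) \<le> ip_norm ip (\<lambda>x. F n x - f x) * ip_norm ip (\<lambda>z. K z w)"
  proof (intro always_eventually allI)
    fix n
    show "norm (F n w - f w) \<le> ip_norm ip (\<lambda>x. F n x - f x) * ip_norm ip (\<lambda>z. K z w)"
      using Cauchy_Schwarz[OF diff_mem[OF assms(1)[of n] assms(2)] kernel_mem[OF assms(4)]]
        reproducing[OF diff_mem[OF assms(1)[of n] assms(2)] assms(4)] by simp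
  qed
qed

section \<open>Density of the kernel functions\<close>

lemma kernel_span_mem: "s \<in> kernel_span X K \<Longrightarrow> s \<in> H"
  by (induction rule: kernel_span.induct) (simp_all add: zero_mem add_mem scale_mem kernel_mem)

lemma complete_ip_norm:
  assumes "\<And>n. F n \<in> H"
    and "\<And>e. 0 < e \<Longrightarrow> \<exists>N. \<forall>m\<ge>N. \<forall>n\<ge>N. ip_norm ip (\<lambda>x. F m x - F n x) < e"
  obtains f where "f \<in> H" "(\<lambda>n. ip_norm ip (\<lambda>x. F n x - f x)) \<longlonglongrightarrow> 0"
proof -
  have "\<exists>f\<in>H. (\<lambda>n. ip_norm ip (\<lambda>x. F n x - f x)) \<longlonglongrightarrow> 0"
    unfolding ip_norm_def
    by (rule complete[OF assms(1)]) (rule assms(2)[unfolded ip_norm_def])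
  then show thesis using that by blast
qed

lemma kernel_span_dense:
  assumes f: "f \<in> H"
  obtains F where "\<And>n. F n \<in> kernel_span X K" "(\<lambda>n. ip_norm ip (\<lambda>x. F n x - f x)) \<longlonglongrightarrow> 0"
proof -
  \<comment> \<open>A minimizing sequence for the distance from \<open>f\<close> to the span converges to some \<open>p\<close>; since
    \<open>f - p\<close> is orthogonal to every kernel function, it vanishes on \<open>X\<close>.\<close>
  define D where "D s = (ip_norm ip (\<lambda>x. f x - s x))\<^sup>2" for s
  define d where "d = Inf (D ` kernel_span X K)"
  have ne: "D ` kernel_span X K \<noteq> {}" using kernel_span.zero by blast
  have bdd: "bdd_below (D ` kernel_span X K)"
    by (rule bdd_belowI[of _ 0]) (auto simp: D_def)
  have d_le: "d \<le> D s" if "s \<in> kernel_span X K" for s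
    unfolding d_def using bdd that by (intro cInf_lower) auto
  have "\<exists>s\<in>kernel_span X K. D s < d + 1 / Suc n" for n
    using cInf_lessD[OF ne, of "d + 1 / Suc n"] by (auto simp: d_def)
  then obtain F where F: "\<And>n. F n \<in> kernel_span X K" "\<And>n. D (F n) < d + 1 / Suc n"
    by metis
  have FH: "F n \<in> H" for n using F(1) by (rule kernel_span_mem)
  \<comment> \<open>The midpoint of \<open>F m\<close> and \<open>F n\<close> lies in the span, so
    its distance from \<open>f\<close> is at least the infimum. As \<open>u + v\<close> is twice
    \<open>h\<close>, the parallelogram law leaves only the two errors of the minimizing
    sequence.\<close>
  have parallelogram: "(ip_norm ip (\<lambda>x. F m x - F n x))\<^sup>2 < 2 / Suc m + 2 / Suc n" for m n
  proof -
    define u v where "u = (\<lambda>x. f x - F n x)" and "v = (\<lambda>x. f x - F m x)"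
    have uv: "u \<in> H" "v \<in> H" unfolding u_def v_def by (intro diff_mem f FH)+
    have mid: "(\<lambda>x. (1 / 2) * (F m x + F n x)) \<in> kernel_span X K"
      by (intro kernel_span_scale kernel_span_add F)
    define h where "h = (\<lambda>x. f x - (1 / 2) * (F m x + F n x))"
    have hH: "h \<in> H" unfolding h_def by (intro diff_mem f kernel_span_mem mid)
    have dh: "d \<le> (ip_norm ip h)\<^sup>2" using d_le[OF mid] by (simp add: D_def h_def)
    have "(ip_norm ip (\<lambda>x. u x - 1 * v x))\<^sup>2 + (ip_norm ip (\<lambda>x. u x - (-1) * v x))\<^sup>2
      = 2 * (ip_norm ip u)\<^sup>2 + 2 * (ip_norm ip v)\<^sup>2"
      unfolding ip_norm_diff_scale_square[OF uv] by simp
    moreover have "(\<lambda>x. u x - (-1) * v x) = (\<lambda>x. 0 * h x - (-2) * h x)"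
      by (auto simp: u_def v_def h_def algebra_simps)
    moreover have "(ip_norm ip (\<lambda>x. 0 * h x - (-2) * h x))\<^sup>2 = 4 * (ip_norm ip h)\<^sup>2"
      using ip_scale_left[OF hH, of "\<lambda>x. 2 * h x" 2] ip_scale_right[OF hH hH, of 2] scale_mem[OF hH, of 2]
      by (simp add: ip_norm_square hH)
    moreover have "(\<lambda>x. u x - 1 * v x) = (\<lambda>x. F m x - F n x)"
      by (auto simp: u_def v_def)
    moreover have "(ip_norm ip u)\<^sup>2 < d + 1 / Suc n" "(ip_norm ip v)\<^sup>2 < d + 1 / Suc m"
      using F(2)[of n] F(2)[of m] by (simp_all add: D_def u_def v_def)
    ultimately have "(ip_norm ip (\<lambda>x. F m x - F n x))\<^sup>2 + 4 * (ip_norm ip h)\<^sup>2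
        < 2 * (d + 1 / Suc n) + 2 * (d + 1 / Suc m)"
      by simp
    with dh show ?thesis by simp
  qed
  have "\<exists>N. \<forall>m\<ge>N. \<forall>n\<ge>N. ip_norm ip (\<lambda>x. F m x - F n x) < e" if e: "0 < e" for e
  proof -
    \<comment> \<open>For indices beyond \<open>N\<close> the parallelogram bound is at most
      \<open>4 / N\<close>, which must be below the square of \<open>e\<close>.\<close>
    obtain N :: nat where N: "4 / e\<^sup>2 < real N" using reals_Archimedean2 by blast
    have "ip_norm ip (\<lambda>x. F m x - F n x) < e" if "m \<ge> N" "n \<ge> N" for m n
    proof -
      have "0 < real N" using N e by (smt (verit) divide_pos_pos zero_less_power)
      have "1 / real (Suc k) \<le> 1 / real N" if "k \<ge> N" for k
        using that \<open>0 < real N\<close> by (intro divide_left_mono) auto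
      from this[OF \<open>m \<ge> N\<close>] this[OF \<open>n \<ge> N\<close>]
      have "2 / real (Suc m) + 2 / real (Suc n) \<le> 4 / real N" by simp
      also have "\<dots> < e\<^sup>2" using N e \<open>0 < real N\<close> by (simp add: field_simps)
      finally have "(ip_norm ip (\<lambda>x. F m x - F n x))\<^sup>2 < e\<^sup>2"
        using parallelogram[of m n] by simp
      then show ?thesis by (rule power_less_imp_less_base) (use e in simp)
    qed
    then show ?thesis by blast
  qed
  from complete_ip_norm[OF FH this] obtain p where
    p: "p \<in> H" "(\<lambda>n. ip_norm ip (\<lambda>x. F n x - p x)) \<longlonglongrightarrow> 0" by blast
  define g where "g = (\<lambda>x. f x - p x)"
  have gH: "g \<in> H" unfolding g_def by (intro diff_mem f p)
  \<comment> \<open>The point \<open>p\<close> need not lie in the span, so every statement about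
    \<open>g = f - p\<close> is obtained as a limit of the corresponding statement about
    \<open>f - F n\<close>.\<close>
  have lim: "(\<lambda>n. ip_norm ip (\<lambda>x. (f x - F n x) - h x)) \<longlonglongrightarrow> ip_norm ip (\<lambda>x. g x - h x)"
    if h: "h \<in> H" for h
  proof (rule ip_norm_tendsto)
    have "ip_norm ip (\<lambda>x. f x - F n x - h x - (g x - h x)) = ip_norm ip (\<lambda>x. F n x - p x)" for n
      using ip_norm_diff_commute[OF FH[of n] p(1)] by (simp add: g_def)
    then show "(\<lambda>n. ip_norm ip (\<lambda>x. f x - F n x - h x - (g x - h x))) \<longlonglongrightarrow> 0"
      using p(2) by simp
  qed (intro diff_mem f FH h gH)+
  have gd: "(ip_norm ip g)\<^sup>2 \<le> d"
  proof (rule LIMSEQ_le)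
    show "(\<lambda>n. D (F n)) \<longlonglongrightarrow> (ip_norm ip g)\<^sup>2"
      using tendsto_power[OF lim[OF zero_mem], of 2] by (simp add: D_def)
    show "(\<lambda>n. d + 1 / Suc n) \<longlonglongrightarrow> d"
      using tendsto_add[OF tendsto_const LIMSEQ_inverse_real_of_nat, of d] by (simp add: inverse_eq_divide)
    show "\<exists>N. \<forall>n\<ge>N. D (F n) \<le> d + 1 / Suc n" using F(2) less_imp_le by blast
  qed
  have "g w = 0" if w: "w \<in> X" for w
  proof (rule ccontr)
    assume nz: "g w \<noteq> 0"
    define k where "k = (\<lambda>z. K z w)"
    have kH: "k \<in> H" and ipk: "ip g k = g w"
      using kernel_mem[OF w] reproducing[OF gH w] by (auto simp: k_def)
    define B where "B = (ip_norm ip k)\<^sup>2"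
    \<comment> \<open>The optimal multiple would be \<open>g w / B\<close>. Dividing by
      \<open>B + 1\<close> avoids separating the case \<open>B = 0\<close> and still lowers the
      squared norm by at least \<open>|g w|^2 / (B + 1)\<close>.\<close>
    define c where "c = of_real (1 / (B + 1)) * g w"
    have B: "0 \<le> B" by (simp add: B_def)
    \<comment> \<open>Subtracting \<open>c * k\<close> from \<open>f - F n\<close> leaves the
      difference of \<open>f\<close> and another member of the span, so the infimum bounds each
      approximating term.\<close>
    have "d \<le> (ip_norm ip (\<lambda>x. g x - c * k x))\<^sup>2"
    proof (rule LIMSEQ_le_const)
      show "(\<lambda>n. (ip_norm ip (\<lambda>x. (f x - F n x) - c * k x))\<^sup>2) \<longlonglongrightarrow> (ip_norm ip (\<lambda>x. g x - c * k x))\<^sup>2"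
        by (intro tendsto_power lim scale_mem kH)
      have "(ip_norm ip (\<lambda>x. (f x - F n x) - c * k x))\<^sup>2 = D (\<lambda>z. c * K z w + F n z)" for n
        by (simp add: D_def k_def algebra_simps)
      then show "\<exists>N. \<forall>n\<ge>N. d \<le> (ip_norm ip (\<lambda>x. (f x - F n x) - c * k x))\<^sup>2"
        using d_le kernel_span.step[OF F(1) w] by simp
    qed
    also have "\<dots> = (ip_norm ip g)\<^sup>2 - 2 * Re (cnj c * g w) + (cmod c)\<^sup>2 * B"
      unfolding ip_norm_diff_scale_square[OF gH kH] ipk B_def ..
    also have "cnj c * g w = of_real ((cmod (g w))\<^sup>2 / (B + 1))"
      using complex_norm_square[of "g w"] by (simp add: c_def mult.commute)
    also have "(cmod c)\<^sup>2 * B = (cmod (g w))\<^sup>2 / (B + 1) * (B / (B + 1))"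
      using B norm_of_real[of "B + 1", where 'a = complex] by (simp add: c_def norm_mult norm_divide power2_eq_square)
    also have "\<dots> \<le> (cmod (g w))\<^sup>2 / (B + 1)"
      using B by (intro mult_left_le) auto
    finally have "d \<le> (ip_norm ip g)\<^sup>2 - (cmod (g w))\<^sup>2 / (B + 1)"
      by simp
    moreover have "0 < (cmod (g w))\<^sup>2 / (B + 1)" using nz B by simp
    ultimately show False using gd by linarith
  qed
  then have "ip_norm ip (\<lambda>x. F n x - f x) = ip_norm ip (\<lambda>x. F n x - p x)" for n
    by (intro ip_norm_cong diff_mem FH f p) (simp add: g_def)
  then have "(\<lambda>n. ip_norm ip (\<lambda>x. F n x - f x)) \<longlonglongrightarrow> 0" using p(2) by simp
  with F(1) show thesis by (rule that)
qed

end

section \<open>Comparison of two spaces with the same kernel\<close>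

text \<open>Induction is on the second argument, since the reproducing property gives the same value
  \<open>s w\<close> for the pairing of \<open>s\<close> with a kernel function in both
  spaces.\<close>

lemma kernel_span_ip_unique:
  assumes "reproducing_kernel_hilbert_space X K H ip" "reproducing_kernel_hilbert_space X K H' ip'"
    and "s \<in> kernel_span X K" "t \<in> kernel_span X K"
  shows "ip s t = ip' s t"
proof -
  interpret A: reproducing_kernel_hilbert_space X K H ip by fact
  interpret B: reproducing_kernel_hilbert_space X K H' ip' by fact
  have s: "s \<in> H" "s \<in> H'"
    using assms(3) A.kernel_span_mem B.kernel_span_mem by auto
  show ?thesis
    using assms(4)
  proof (induction rule: kernel_span.induct)
    case zero
    show ?case
      using A.ip_scale_right[OF A.zero_mem s(1), of 0] B.ip_scale_right[OF B.zero_mem s(2), of 0] by simp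
  next
    case (step t w c)
    have t: "t \<in> H" "t \<in> H'" using step A.kernel_span_mem B.kernel_span_mem by auto
    show ?case
      using step s t
      by (simp add: A.ip_add_right B.ip_add_right A.scale_mem B.scale_mem A.kernel_mem B.kernel_mem
          A.ip_scale_right B.ip_scale_right A.reproducing B.reproducing)
  qed
qed

text \<open>Approximants of \<open>f\<close> from the kernel span are Cauchy in the second norm too,
  because the two norms agree on the span. Their limit in the second space has the same values as
  \<open>f\<close> on \<open>X\<close>, and norms pass to the limit.\<close>

lemma rkhs_subset_isometric:
  assumes "reproducing_kernel_hilbert_space X K H ip" "reproducing_kernel_hilbert_space X K H' ip'"
    and f: "f \<in> H"
  shows "f \<in> H' \<and> ip_norm ip f = ip_norm ip' f"
proof -
  interpret A: reproducing_kernel_hilbert_space X K H ip by fact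
  interpret B: reproducing_kernel_hilbert_space X K H' ip' by fact
  obtain F where F: "\<And>n. F n \<in> kernel_span X K" "(\<lambda>n. ip_norm ip (\<lambda>x. F n x - f x)) \<longlonglongrightarrow> 0"
    using A.kernel_span_dense[OF f] by blast
  have FA: "F n \<in> H" and FB: "F n \<in> H'" for n
    using F(1) A.kernel_span_mem B.kernel_span_mem by auto
  have same: "ip_norm ip s = ip_norm ip' s" if "s \<in> kernel_span X K" for s
    using kernel_span_ip_unique[OF assms(1,2) that that] by (simp add: ip_norm_def)
  have "\<exists>N. \<forall>m\<ge>N. \<forall>n\<ge>N. ip_norm ip' (\<lambda>x. F m x - F n x) < e" if e: "0 < e" for e
  proof -
    obtain N where N: "\<And>n. n \<ge> N \<Longrightarrow> ip_norm ip (\<lambda>x. F n x - f x) < e / 2"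
      using order_tendstoD(2)[OF F(2), of "e/2"] e unfolding eventually_sequentially by auto
    have "ip_norm ip' (\<lambda>x. F m x - F n x) < e" if "m \<ge> N" "n \<ge> N" for m n
    proof -
      have "(\<lambda>x. F m x + (-1) * F n x) \<in> kernel_span X K"
        by (intro kernel_span_add kernel_span_scale F)
      then have "ip_norm ip' (\<lambda>x. F m x - F n x) = ip_norm ip (\<lambda>x. F m x - F n x)"
        using same by simp
      also have "\<dots> \<le> ip_norm ip (\<lambda>x. F m x - f x) + ip_norm ip (\<lambda>x. F m x - F n x - (F m x - f x))"
        by (intro A.ip_norm_triangle A.diff_mem FA f)
      also have "ip_norm ip (\<lambda>x. F m x - F n x - (F m x - f x)) = ip_norm ip (\<lambda>x. F n x - f x)"
        using A.ip_norm_diff_commute[OF FA[of n] f] by simp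
      also have "ip_norm ip (\<lambda>x. F m x - f x) + \<dots> < e" using N[OF that(1)] N[OF that(2)] by linarith
      finally show ?thesis .
    qed
    then show ?thesis by blast
  qed
  from B.complete_ip_norm[OF FB this] obtain g where
    g: "g \<in> H'" "(\<lambda>n. ip_norm ip' (\<lambda>x. F n x - g x)) \<longlonglongrightarrow> 0" by blast
  have eq: "f w = g w" if "w \<in> X" for w
    using A.eval_tendsto[OF FA f F(2) that] B.eval_tendsto[OF FB g that] by (rule LIMSEQ_unique)
  \<comment> \<open>\<open>f\<close> and \<open>g\<close> agree only on \<open>X\<close>; closure of
    \<open>H'\<close> under agreement on \<open>X\<close> puts \<open>f\<close> itself into the
    second space.\<close>
  then have fB: "f \<in> H'" by (intro B.mem_cong[OF g(1)]) auto
  have "(\<lambda>n. ip_norm ip' (F n)) \<longlonglongrightarrow> ip_norm ip f"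
    using A.ip_norm_tendsto[OF FA f F(2)] same[OF F(1)] by simp
  moreover have "(\<lambda>n. ip_norm ip' (F n)) \<longlonglongrightarrow> ip_norm ip' g"
    by (rule B.ip_norm_tendsto[OF FB g])
  moreover have "ip_norm ip' f = ip_norm ip' g"
    by (rule B.ip_norm_cong[OF fB g(1) eq])
  ultimately show ?thesis using fB LIMSEQ_unique by metis
qed

lemma rkhs_unique:
  assumes "reproducing_kernel_hilbert_space X K H ip" "reproducing_kernel_hilbert_space X K H' ip'"
  shows "f \<in> H \<longleftrightarrow> f \<in> H'" "f \<in> H \<Longrightarrow> ip_norm ip f = ip_norm ip' f"
  using rkhs_subset_isometric[OF assms, of f] rkhs_subset_isometric[OF assms(2,1), of f] by blast+

section \<open>Taylor coefficients and the Hardy space\<close>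

abbreviation disk :: "complex set" where "disk \<equiv> ball 0 1"

abbreviation tcoeff :: "(complex \<Rightarrow> complex) \<Rightarrow> nat \<Rightarrow> complex" where
  "tcoeff f n \<equiv> taylor_coeff f (int n)"

abbreviation circle_measure :: "real measure" where
  "circle_measure \<equiv> lebesgue_on {0..2 * pi}"

lemma tcoeff_sums:
  assumes "f holomorphic_on disk" "cmod z < 1"
  shows "(\<lambda>n. tcoeff f n * z ^ n) sums f z"
  using holomorphic_power_series[OF assms(1), of z] assms(2) by (simp add: taylor_coeff_def)

lemma tcoeff_summable_norm:
  assumes "f holomorphic_on disk" "0 \<le> r" "r < 1"
  shows "summable (\<lambda>n. cmod (tcoeff f n) * r ^ n)"
proof -
  obtain R where R: "r < R" "R < 1" using dense[OF assms(3)] by auto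
  then have "summable (\<lambda>n. tcoeff f n * of_real R ^ n)"
    using tcoeff_sums[OF assms(1), of "of_real R"] assms(2) by (auto simp: sums_iff)
  then have "summable (\<lambda>n. norm (tcoeff f n * of_real r ^ n))"
    by (rule powser_insidea) (use R assms in auto)
  then show ?thesis using assms(2) by (simp add: norm_mult norm_power)
qed

text \<open>Uniqueness of power series expansions: exhibiting a convergent expansion on the disk
  settles holomorphy and the coefficients at once. The coefficient computations below go through
  this rule.\<close>

lemma tcoeffI:
  assumes "\<And>z. cmod z < 1 \<Longrightarrow> (\<lambda>n. a n * z ^ n) sums f z"
  shows "f holomorphic_on disk" "tcoeff f = a"
proof -
  show "f holomorphic_on disk"
    by (rule power_series_holomorphic[where a = a]) (use assms in simp)
  have "f has_fps_expansion Abs_fps a"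
  proof (rule has_fps_expansionI)
    show "\<forall>\<^sub>F u in nhds 0. (\<lambda>n. fps_nth (Abs_fps a) n * u ^ n) sums f u"
      by (rule eventually_mono[OF eventually_nhds_in_open[of disk 0]]) (use assms in auto)
  qed
  from fps_nth_fps_expansion[OF this] show "tcoeff f = a"
    by (simp add: taylor_coeff_def fun_eq_iff)
qed

lemma tcoeff_cong:
  assumes "f holomorphic_on disk" "\<And>z. cmod z < 1 \<Longrightarrow> f z = g z"
  shows "tcoeff f = tcoeff g"
  by (rule tcoeffI(2)[symmetric]) (use tcoeff_sums[OF assms(1)] assms(2) in auto)

lemma tcoeff_zero: "tcoeff (\<lambda>_. 0) = (\<lambda>_. 0)"
  by (rule tcoeffI) simp

lemma tcoeff_add:
  assumes "f holomorphic_on disk" "g holomorphic_on disk"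
  shows "tcoeff (\<lambda>z. f z + g z) = (\<lambda>n. tcoeff f n + tcoeff g n)"
  by (rule tcoeffI) (use sums_add[OF tcoeff_sums[OF assms(1)] tcoeff_sums[OF assms(2)]] in \<open>simp add: distrib_right\<close>)

lemma tcoeff_diff:
  assumes "f holomorphic_on disk" "g holomorphic_on disk"
  shows "tcoeff (\<lambda>z. f z - g z) = (\<lambda>n. tcoeff f n - tcoeff g n)"
  by (rule tcoeffI) (use sums_diff[OF tcoeff_sums[OF assms(1)] tcoeff_sums[OF assms(2)]] in \<open>simp add: left_diff_distrib\<close>)

lemma tcoeff_scale:
  assumes "f holomorphic_on disk"
  shows "tcoeff (\<lambda>z. c * f z) = (\<lambda>n. c * tcoeff f n)"
  by (rule tcoeffI) (use sums_mult[OF tcoeff_sums[OF assms]] in \<open>simp add: mult.assoc\<close>)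

lemma tcoeff_dilate:
  assumes "f holomorphic_on disk" "cmod r \<le> 1"
  shows "tcoeff (\<lambda>z. f (r * z)) = (\<lambda>n. r ^ n * tcoeff f n)"
proof (rule tcoeffI)
  fix z :: complex assume "cmod z < 1"
  then have "cmod (r * z) < 1" using assms(2) mult_left_le_one_le[of "cmod z" "cmod r"] by (simp add: norm_mult)
  then show "(\<lambda>n. r ^ n * tcoeff f n * z ^ n) sums f (r * z)"
    using tcoeff_sums[OF assms(1), of "r * z"] by (simp add: power_mult_distrib mult_ac)
qed

lemma tcoeff_mult:
  assumes "f holomorphic_on disk" "g holomorphic_on disk"
  shows "tcoeff (\<lambda>z. f z * g z) = (\<lambda>n. \<Sum>i\<le>n. tcoeff f i * tcoeff g (n - i))"
proof (rule tcoeffI)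
  fix z :: complex assume z: "cmod z < 1"
  have s: "summable (\<lambda>n. norm (tcoeff h n * z ^ n))" if "h holomorphic_on disk" for h
    using tcoeff_summable_norm[OF that, of "cmod z"] z by (simp add: norm_mult norm_power)
  have "(\<lambda>n. \<Sum>i\<le>n. tcoeff f i * z ^ i * (tcoeff g (n - i) * z ^ (n - i))) sums (f z * g z)"
    using Cauchy_product_sums[OF s[OF assms(1)] s[OF assms(2)]]
      sums_unique[OF tcoeff_sums[OF assms(1) z]] sums_unique[OF tcoeff_sums[OF assms(2) z]] by simp
  moreover have "(\<Sum>i\<le>n. tcoeff f i * z ^ i * (tcoeff g (n - i) * z ^ (n - i))) =
      (\<Sum>i\<le>n. tcoeff f i * tcoeff g (n - i)) * z ^ n" for n
    unfolding sum_distrib_right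
  proof (rule sum.cong)
    fix i assume "i \<in> {..n}"
    then have "z ^ n = z ^ i * z ^ (n - i)" by (simp flip: power_add)
    then show "tcoeff f i * z ^ i * (tcoeff g (n - i) * z ^ (n - i)) =
        tcoeff f i * tcoeff g (n - i) * z ^ n" by simp
  qed simp
  ultimately show "(\<lambda>n. (\<Sum>i\<le>n. tcoeff f i * tcoeff g (n - i)) * z ^ n) sums (f z * g z)"
    by simp
qed

lemma tcoeff_shift:
  assumes "f holomorphic_on disk"
  shows "tcoeff (\<lambda>z. z ^ m * f z) n = (if m \<le> n then tcoeff f (n - m) else 0)"
proof -
  have "tcoeff (\<lambda>z. z ^ m * f z) = (\<lambda>n. if m \<le> n then tcoeff f (n - m) else 0)"
  proof (rule tcoeffI)
    fix z :: complex assume z: "cmod z < 1"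
    let ?b = "\<lambda>n. (if m \<le> n then tcoeff f (n - m) else 0) * z ^ n"
    have "(\<lambda>n. ?b (n + m)) sums (z ^ m * f z - (\<Sum>i<m. ?b i))"
      using sums_mult[OF tcoeff_sums[OF assms z], of "z ^ m"] by (simp add: power_add mult_ac)
    then show "?b sums (z ^ m * f z)"
      by (subst (asm) sums_iff_shift) simp
  qed
  from fun_cong[OF this, of n] show ?thesis .
qed

section \<open>Fourier integrals on circles and Parseval's identity\<close>

lemma integrable_circle:
  fixes f :: "real \<Rightarrow> 'a::euclidean_space"
  shows "continuous_on {0..2 * pi} f \<Longrightarrow> integrable circle_measure f"
  by (rule continuous_imp_integrable_real)

lemma continuous_on_circle:
  assumes "f holomorphic_on disk" "0 \<le> r" "r < 1"
  shows "continuous_on A (\<lambda>t. f (of_real r * cis t))"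
proof -
  have "continuous_on A (\<lambda>t. of_real r * cis t)"
    by (intro continuous_intros)
  moreover have "(\<lambda>t. of_real r * cis t) ` A \<subseteq> disk"
    using assms by (auto simp: norm_mult)
  ultimately show ?thesis
    using continuous_on_compose2[OF holomorphic_on_imp_continuous_on[OF assms(1)]] by blast
qed

lemma integral_cis_power:
  "(LINT t|circle_measure. cis t ^ m * cnj (cis t ^ n)) = (if m = n then 2 * pi else 0)"
proof -
  have *: "integral {0..2 * pi} (\<lambda>t. cis (k * t)) = 0" if "k = of_int j" "j \<noteq> 0" for k :: real and j
  proof -
    have "((\<lambda>t. cis (k * t)) has_integral (cis (k * (2 * pi)) / (\<i> * k) - cis (k * 0) / (\<i> * k))) {0..2 * pi}"
      using that by (intro fundamental_theorem_of_calculus)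
        (auto intro!: derivative_eq_intros simp: has_vector_derivative_def scaleR_conv_of_real fun_eq_iff
          mult.left_commute[of "complex_of_real y" \<i> for y])
    moreover have "cis (k * (2 * pi)) = 1"
      using that cis_multiple_2pi[of "of_int j"] by (simp add: mult_ac)
    ultimately show ?thesis by (simp add: integral_unique)
  qed
  have "cis t ^ m * cnj (cis t ^ n) = cis ((real m - real n) * t)" for t
    by (simp only: complex_cnj_power cis_cnj Complex.DeMoivre cis_mult) (simp add: left_diff_distrib)
  then have "(LINT t|circle_measure. cis t ^ m * cnj (cis t ^ n))
      = integral {0..2 * pi} (\<lambda>t. cis ((real m - real n) * t))"
    by (simp add: lebesgue_integral_eq_integral integrable_circle continuous_intros)
  also have "\<dots> = (if m = n then 2 * pi else 0)"
    using *[of "real m - real n" "int m - int n"] by (auto simp: scaleR_conv_of_real)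
  finally show ?thesis .
qed

text \<open>At a radius below one the Taylor series converges absolutely and uniformly in the angle,
  so it may be integrated term by term; orthogonality keeps one term.\<close>

lemma circle_coefficient:
  assumes "g holomorphic_on disk" "0 \<le> r" "r < 1"
  shows "(LINT t|circle_measure. g (of_real r * cis t) * cnj (cis t ^ n)) = 2 * pi * (tcoeff g n * of_real r ^ n)"
proof -
  define h where "h m t = tcoeff g m * of_real r ^ m * (cis t ^ m * cnj (cis t ^ n))" for m t
  have norm_h: "norm (h m t) = cmod (tcoeff g m) * r ^ m" for m t
    using assms by (simp add: h_def norm_mult norm_power)
  have "(\<lambda>m. LINT t|circle_measure. h m t) sums (LINT t|circle_measure. (\<Sum>m. h m t))"
  proof (rule sums_integral)
    show "integrable circle_measure (h m)" for m
      unfolding h_def by (intro integrable_circle continuous_intros)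
    show "AE t in circle_measure. summable (\<lambda>m. norm (h m t))"
      using tcoeff_summable_norm[OF assms] by (simp add: norm_h)
    show "summable (\<lambda>m. LINT t|circle_measure. norm (h m t))"
      unfolding norm_h using summable_mult[OF tcoeff_summable_norm[OF assms], of "2 * pi"]
      by (simp add: measure_restrict_space mult.assoc)
  qed
  moreover have "(\<Sum>m. h m t) = g (of_real r * cis t) * cnj (cis t ^ n)" for t
  proof -
    have "(\<lambda>m. tcoeff g m * (of_real r * cis t) ^ m * cnj (cis t ^ n)) sums (g (of_real r * cis t) * cnj (cis t ^ n))"
      using assms by (intro sums_mult2 tcoeff_sums) (auto simp: norm_mult)
    then show ?thesis by (simp add: h_def power_mult_distrib mult_ac sums_iff)
  qed
  moreover have "(LINT t|circle_measure. h m t) = (if m = n then 2 * pi * (tcoeff g n * of_real r ^ n) else 0)" for m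
    unfolding h_def integral_mult_right_zero integral_cis_power by auto
  ultimately have "(\<lambda>m. if m = n then 2 * pi * (tcoeff g n * of_real r ^ n) else 0) sums
      (LINT t|circle_measure. g (of_real r * cis t) * cnj (cis t ^ n))"
    by simp
  moreover have "(\<lambda>m. if m = n then 2 * pi * (tcoeff g n * of_real r ^ n) else 0) sums
      (2 * pi * (tcoeff g n * of_real r ^ n))"
    by (rule sums_single)
  ultimately show ?thesis by (rule sums_unique2)
qed

text \<open>Only \<open>f\<close> is expanded. Each term then integrates to the conjugate of a
  Fourier coefficient of \<open>g\<close>, given by \<open>circle_coefficient\<close>, so no double
  series arises.\<close>

lemma Parseval_circle:
  assumes f: "f holomorphic_on disk" and g: "g holomorphic_on disk" and r: "0 \<le> r" "r < 1"
  shows "(\<lambda>n. tcoeff f n * cnj (tcoeff g n) * of_real (r\<^sup>2 ^ n)) sums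
    ((LINT t|circle_measure. f (of_real r * cis t) * cnj (g (of_real r * cis t))) / (2 * pi))"
proof -
  define h where "h m t = tcoeff f m * of_real r ^ m * (cis t ^ m * cnj (g (of_real r * cis t)))" for m t
  have cont: "continuous_on {0..2 * pi} (\<lambda>t. g (of_real r * cis t))"
    by (rule continuous_on_circle[OF g r])
  have norm_h: "norm (h m t) = cmod (tcoeff f m) * r ^ m * cmod (g (of_real r * cis t))" for m t
    using r by (simp add: h_def norm_mult norm_power)
  have int: "integrable circle_measure (\<lambda>t. cmod (g (of_real r * cis t)))"
    by (intro integrable_circle continuous_intros cont)
  have "(\<lambda>m. LINT t|circle_measure. h m t) sums (LINT t|circle_measure. (\<Sum>m. h m t))"
  proof (rule sums_integral)
    show "integrable circle_measure (h m)" for m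
      unfolding h_def by (intro integrable_circle continuous_intros cont)
    show "AE t in circle_measure. summable (\<lambda>m. norm (h m t))"
      unfolding norm_h by (intro AE_I2 summable_mult2 tcoeff_summable_norm f r)
    show "summable (\<lambda>m. LINT t|circle_measure. norm (h m t))"
      unfolding norm_h integral_mult_right_zero by (intro summable_mult2 tcoeff_summable_norm f r)
  qed
  moreover have "(\<Sum>m. h m t) = f (of_real r * cis t) * cnj (g (of_real r * cis t))" for t
  proof -
    have "(\<lambda>m. tcoeff f m * (of_real r * cis t) ^ m * cnj (g (of_real r * cis t))) sums
        (f (of_real r * cis t) * cnj (g (of_real r * cis t)))"
      using r by (intro sums_mult2 tcoeff_sums f) (auto simp: norm_mult)
    then show ?thesis by (simp add: h_def power_mult_distrib mult_ac sums_iff)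
  qed
  moreover have "(LINT t|circle_measure. h m t) = 2 * pi * (tcoeff f m * cnj (tcoeff g m) * of_real (r\<^sup>2 ^ m))" for m
  proof -
    have "(LINT t|circle_measure. cis t ^ m * cnj (g (of_real r * cis t)))
        = (LINT t|circle_measure. cnj (g (of_real r * cis t) * cnj (cis t ^ m)))"
      by (simp add: mult.commute)
    also have "\<dots> = cnj (LINT t|circle_measure. g (of_real r * cis t) * cnj (cis t ^ m))"
      by (rule Bochner_Integration.integral_cnj)
    also have "\<dots> = cnj (2 * pi * (tcoeff g m * of_real r ^ m))"
      by (simp only: circle_coefficient[OF g r])
    finally show ?thesis
      unfolding h_def integral_mult_right_zero
      by (simp add: power2_eq_square power_mult_distrib)
  qed
  ultimately have "(\<lambda>m. 2 * pi * (tcoeff f m * cnj (tcoeff g m) * of_real (r\<^sup>2 ^ m))) sums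
      (LINT t|circle_measure. f (of_real r * cis t) * cnj (g (of_real r * cis t)))"
    by simp
  from sums_divide[OF this, of "2 * pi"] show ?thesis by simp
qed

section \<open>Circle means and membership in the Hardy space\<close>

text \<open>A Lebesgue integral is used so that monotonicity and dominated convergence apply;
  \<open>circle_mean_eq_integral\<close> reconciles it with the gauge integral in
  \<open>hardy2\<close>.\<close>

definition circle_mean :: "(complex \<Rightarrow> complex) \<Rightarrow> real \<Rightarrow> real" where
  "circle_mean f r = (LINT t|circle_measure. (cmod (f (of_real r * cis t)))\<^sup>2) / (2 * pi)"

lemma circle_mean_sums:
  assumes f: "f holomorphic_on disk" and r: "0 \<le> r" "r < 1"
  shows "(\<lambda>n. (cmod (tcoeff f n))\<^sup>2 * r\<^sup>2 ^ n) sums circle_mean f r"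
proof -
  have "(\<lambda>n. tcoeff f n * cnj (tcoeff f n) * of_real (r\<^sup>2 ^ n)) = (\<lambda>n. of_real ((cmod (tcoeff f n))\<^sup>2 * r\<^sup>2 ^ n))"
    by (simp only: complex_norm_square[symmetric] of_real_mult)
  moreover have "(LINT t|circle_measure. f (of_real r * cis t) * cnj (f (of_real r * cis t))) / (2 * pi)
      = of_real (circle_mean f r)"
    unfolding circle_mean_def complex_norm_square[symmetric] integral_complex_of_real by simp
  ultimately show ?thesis
    using Parseval_circle[OF f f r] by (simp only: sums_of_real_iff)
qed

lemma circle_mean_eq_integral:
  assumes "f holomorphic_on disk" "0 \<le> r" "r < 1"
  shows "circle_mean f r = 1 / (2 * pi) * integral {0..2 * pi} (\<lambda>t. (cmod (f (of_real r * cis t)))\<^sup>2)"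
  unfolding circle_mean_def
  by (subst lebesgue_integral_eq_integral)
    (auto intro!: integrable_circle continuous_intros continuous_on_circle[OF assms])

lemma circle_mean_le:
  assumes f: "f holomorphic_on disk" and r: "0 \<le> r" "r < 1" and sq: "square_summable (tcoeff f)"
  shows "circle_mean f r \<le> (l2_norm (tcoeff f))\<^sup>2"
proof (rule sums_le[OF _ circle_mean_sums[OF f r] l2_norm_power2_sums[OF sq]])
  fix n
  show "(cmod (tcoeff f n))\<^sup>2 * r\<^sup>2 ^ n \<le> (cmod (tcoeff f n))\<^sup>2"
    using r by (intro mult_right_le_one_le power_le_one) (auto simp: power_le_one)
qed

text \<open>Each finite partial sum of the weighted coefficient series is at most the circle mean;
  letting the radius tend to one removes the weights.\<close>

lemma circle_mean_bounded:
  assumes f: "f holomorphic_on disk" and C: "0 \<le> C" "\<And>r. 0 \<le> r \<Longrightarrow> r < 1 \<Longrightarrow> circle_mean f r \<le> C\<^sup>2"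
  shows "square_summable (tcoeff f)" "l2_norm (tcoeff f) \<le> C"
proof -
  have *: "(\<Sum>n<N. (cmod (tcoeff f n))\<^sup>2) \<le> C\<^sup>2" for N
  proof (rule tendsto_upperbound)
    have "((\<lambda>r. \<Sum>n<N. (cmod (tcoeff f n))\<^sup>2 * r\<^sup>2 ^ n) \<longlongrightarrow> (\<Sum>n<N. (cmod (tcoeff f n))\<^sup>2 * 1\<^sup>2 ^ n)) (at_left (1::real))"
      by (intro tendsto_intros)
    then show "((\<lambda>r. \<Sum>n<N. (cmod (tcoeff f n))\<^sup>2 * r\<^sup>2 ^ n) \<longlongrightarrow> (\<Sum>n<N. (cmod (tcoeff f n))\<^sup>2)) (at_left (1::real))"
      by simp
    have "\<forall>\<^sub>F r in at_left 1. 0 < r \<and> r < (1::real)"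
      using eventually_at_left_real[of 0 "1::real"] by simp
    then show "\<forall>\<^sub>F r in at_left (1::real). (\<Sum>n<N. (cmod (tcoeff f n))\<^sup>2 * r\<^sup>2 ^ n) \<le> C\<^sup>2"
    proof eventually_elim
      case (elim r)
      have "(\<Sum>n<N. (cmod (tcoeff f n))\<^sup>2 * r\<^sup>2 ^ n) \<le> circle_mean f r"
        using sum_le_suminf[of "\<lambda>n. (cmod (tcoeff f n))\<^sup>2 * r\<^sup>2 ^ n" "{..<N}"]
          circle_mean_sums[OF f, of r] elim
        by (auto simp: sums_iff)
      also have "\<dots> \<le> C\<^sup>2" using C(2)[of r] elim by simp
      finally show ?case .
    qed
  qed simp
  from l2_norm_bound[OF C(1) *] show "square_summable (tcoeff f)" "l2_norm (tcoeff f) \<le> C" .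
qed

text \<open>By Parseval the circle mean is the coefficient series with weights
  \<open>r ^ (2 * n)\<close>, so bounded means and square-summable coefficients are the same
  condition. \<open>hardy2\<close> is handled through coefficients from here on.\<close>

lemma hardy2_iff: "f \<in> hardy2 \<longleftrightarrow> f holomorphic_on disk \<and> square_summable (tcoeff f)"
proof (cases "f holomorphic_on disk")
  case f: True
  have "f \<in> hardy2 \<longleftrightarrow> bdd_above (circle_mean f ` {0..<1})"
    using f by (auto simp: hardy2_def circle_mean_eq_integral cong: image_cong_simp)
  also have "\<dots> \<longleftrightarrow> square_summable (tcoeff f)"
  proof
    assume "bdd_above (circle_mean f ` {0..<1})"
    then obtain B where B: "\<And>r. 0 \<le> r \<Longrightarrow> r < 1 \<Longrightarrow> circle_mean f r \<le> B"
      unfolding bdd_above_def by fastforce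
    \<comment> \<open>The bound is put in the form of a square, as
      \<open>circle_mean_bounded\<close> expects; the absolute value spares a proof that
      \<open>B\<close> is nonnegative.\<close>
    then have "circle_mean f r \<le> (sqrt \<bar>B\<bar>)\<^sup>2" if "0 \<le> r" "r < 1" for r
      using that by fastforce
    from circle_mean_bounded(1)[OF f _ this] show "square_summable (tcoeff f)" by simp
  next
    assume "square_summable (tcoeff f)"
    from circle_mean_le[OF f _ _ this] show "bdd_above (circle_mean f ` {0..<1})"
      by (intro bdd_aboveI2) auto
  qed
  finally show ?thesis using f by simp
qed (simp add: hardy2_def)

text \<open>Pointwise domination compares the circle means radius by radius. This is the main test
  for membership and the source of norm estimates for products.\<close>

lemma hardy2_dominated:
  assumes f: "f holomorphic_on disk" and g: "g \<in> hardy2"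
    and le: "0 \<le> M" "\<And>z. cmod z < 1 \<Longrightarrow> cmod (f z) \<le> M * cmod (g z)"
  shows "f \<in> hardy2" "l2_norm (tcoeff f) \<le> M * l2_norm (tcoeff g)"
proof -
  have gh: "g holomorphic_on disk" and gs: "square_summable (tcoeff g)"
    using g by (auto simp: hardy2_iff)
  have *: "circle_mean f r \<le> (M * l2_norm (tcoeff g))\<^sup>2" if r: "0 \<le> r" "r < 1" for r
  proof -
    have "(LINT t|circle_measure. (cmod (f (of_real r * cis t)))\<^sup>2)
        \<le> (LINT t|circle_measure. M\<^sup>2 * (cmod (g (of_real r * cis t)))\<^sup>2)"
    proof (rule integral_mono)
      fix t
      have "cmod (of_real r * cis t) < 1" using r by (simp add: norm_mult)
      from power_mono[OF le(2)[OF this], of 2]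
      show "(cmod (f (of_real r * cis t)))\<^sup>2 \<le> M\<^sup>2 * (cmod (g (of_real r * cis t)))\<^sup>2"
        by (simp add: power_mult_distrib)
    qed (intro integrable_circle continuous_intros continuous_on_circle[OF f r] continuous_on_circle[OF gh r])+
    then have "circle_mean f r \<le> M\<^sup>2 * circle_mean g r"
      unfolding circle_mean_def integral_mult_right_zero times_divide_eq_right
      by (rule divide_right_mono) simp
    also have "\<dots> \<le> M\<^sup>2 * (l2_norm (tcoeff g))\<^sup>2"
      by (intro mult_left_mono circle_mean_le gh r gs) auto
    finally show ?thesis by (simp add: power_mult_distrib)
  qed
  have "0 \<le> M * l2_norm (tcoeff g)" using le(1) gs by simp
  note circle_mean_bounded[OF f this *]
  then show "f \<in> hardy2" "l2_norm (tcoeff f) \<le> M * l2_norm (tcoeff g)"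
    using f by (auto simp: hardy2_iff)
qed

section \<open>Limits along radii tending to one\<close>

lemma radii_tendsto: "(\<lambda>k. 1 - inverse (real (Suc k))) \<longlonglongrightarrow> 1"
  using LIMSEQ_inverse_real_of_nat_add_minus[of 1] by simp

text \<open>With absolute convergence the unweighted series dominates, and Tannery's theorem
  suffices.\<close>

lemma Abel_sum_tendsto:
  fixes a :: "nat \<Rightarrow> complex"
  assumes a: "summable (\<lambda>n. cmod (a n))" and r: "\<And>k. 0 \<le> r k" "\<And>k. r k \<le> (1::real)" "r \<longlonglongrightarrow> 1"
  shows "(\<lambda>k. \<Sum>n. a n * of_real (r k ^ n)) \<longlonglongrightarrow> (\<Sum>n. a n)"
proof -
  have "(\<lambda>k. a n * of_real (r k ^ n)) \<longlonglongrightarrow> a n * of_real (1 ^ n)" for n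
    by (intro tendsto_intros r)
  moreover have "cmod (a n * of_real (r k ^ n)) \<le> cmod (a n)" for n k
    using r by (auto simp: norm_mult norm_power intro!: mult_right_le_one_le power_le_one)
  ultimately show ?thesis
    using tannerys_theorem[of "\<lambda>n k. a n * of_real (r k ^ n)" a sequentially "\<lambda>n. cmod (a n)"] a
    by (auto simp: case_prod_unfold)
qed

lemma sq_radii:
  "0 \<le> (1 - inverse (real (Suc k)))\<^sup>2" "(1 - inverse (real (Suc k)))\<^sup>2 \<le> 1"
  "(\<lambda>k. (1 - inverse (real (Suc k)))\<^sup>2) \<longlonglongrightarrow> 1"
proof -
  show "(1 - inverse (real (Suc k)))\<^sup>2 \<le> 1"
    by (intro power_le_one) (auto simp: field_simps)
  show "(\<lambda>k. (1 - inverse (real (Suc k)))\<^sup>2) \<longlonglongrightarrow> 1"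
    using tendsto_power[OF radii_tendsto, of 2] by simp
qed simp

text \<open>The inner product of \<open>hardy2\<close> is recovered from interior circles, so no
  boundary functions of \<open>f\<close> and \<open>g\<close> have to be formed.\<close>

lemma circle_inner_tendsto:
  assumes f: "f \<in> hardy2" and g: "g \<in> hardy2"
  shows "(\<lambda>k. (LINT t|circle_measure. f (of_real (1 - inverse (real (Suc k))) * cis t) *
      cnj (g (of_real (1 - inverse (real (Suc k))) * cis t))) / (2 * pi))
    \<longlonglongrightarrow> l2_inner (tcoeff f) (tcoeff g)"
proof -
  have fg: "f holomorphic_on disk" "g holomorphic_on disk" "square_summable (tcoeff f)" "square_summable (tcoeff g)"
    using f g by (auto simp: hardy2_iff)
  define r where "r k = 1 - inverse (real (Suc k))" for k
  have r: "0 \<le> r k" "r k < 1" for k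
    by (auto simp: r_def field_simps)
  have "(\<lambda>k. \<Sum>n. tcoeff f n * cnj (tcoeff g n) * of_real ((r k)\<^sup>2 ^ n)) \<longlonglongrightarrow> (\<Sum>n. tcoeff f n * cnj (tcoeff g n))"
    unfolding r_def by (intro Abel_sum_tendsto sq_radii) (simp add: norm_mult summable_norm_mult fg)
  then show ?thesis
    using sums_unique[OF Parseval_circle[OF fg(1,2) r]] by (simp add: r_def l2_inner_def)
qed

section \<open>Pythagorean pairs\<close>

lemma hardy_infinity_bound:
  assumes "g \<in> hardy_infinity"
  obtains M where "0 \<le> M" "\<And>z. cmod z < 1 \<Longrightarrow> cmod (g z) \<le> M"
proof -
  obtain M where M: "\<And>x. x \<in> g ` disk \<Longrightarrow> cmod x \<le> M"
    using assms unfolding hardy_infinity_def bounded_iff by blast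
  have "cmod (g z) \<le> \<bar>M\<bar>" if "cmod z < 1" for z
    using M[of "g z"] that by force
  then show thesis using that[of "\<bar>M\<bar>"] by simp
qed

lemma one_hardy2: "(\<lambda>_. 1) \<in> hardy2" "tcoeff (\<lambda>_. 1) = (\<lambda>n. if n = 0 then 1 else 0)"
proof -
  have "(\<lambda>n. (if n = 0 then 1 else 0) * z ^ n) sums 1" for z :: complex
    using sums_single[of 0 "\<lambda>n. z ^ n"] by (simp add: if_distrib if_distribR cong: if_cong)
  note * = tcoeffI[of "\<lambda>n. if n = 0 then 1 else 0" "\<lambda>_. 1", OF this]
  show "tcoeff (\<lambda>_. 1) = (\<lambda>n. if n = 0 then 1 else 0)" by (rule *(2))
  show "(\<lambda>_. 1) \<in> hardy2"
    unfolding hardy2_iff square_summable_def *(2)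
    by (auto intro!: summable_finite[of "{0}"] split: if_splits)
qed

lemma hardy_infinity_mult_hardy2:
  assumes "g \<in> hardy_infinity" "f \<in> hardy2"
  shows "(\<lambda>z. g z * f z) \<in> hardy2"
proof -
  obtain M where M: "0 \<le> M" "\<And>z. cmod z < 1 \<Longrightarrow> cmod (g z) \<le> M"
    using hardy_infinity_bound[OF assms(1)] by blast
  show ?thesis
  proof (rule hardy2_dominated(1)[OF _ assms(2) M(1)])
    show "(\<lambda>z. g z * f z) holomorphic_on disk"
      using assms by (intro holomorphic_intros) (auto simp: hardy2_def hardy_infinity_def)
    show "cmod (g z * f z) \<le> M * cmod (f z)" if "cmod z < 1" for z
      using M(2)[OF that] by (simp add: norm_mult mult_right_mono)
  qed
qed

lemma hardy_infinity_mult: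
  assumes "g \<in> hardy_infinity" "f \<in> hardy_infinity"
  shows "(\<lambda>z. g z * f z) \<in> hardy_infinity"
proof -
  obtain M where M: "0 \<le> M" "\<And>z. cmod z < 1 \<Longrightarrow> cmod (g z) \<le> M"
    using hardy_infinity_bound[OF assms(1)] by blast
  obtain N where N: "0 \<le> N" "\<And>z. cmod z < 1 \<Longrightarrow> cmod (f z) \<le> N"
    using hardy_infinity_bound[OF assms(2)] by blast
  have "cmod (g z * f z) \<le> M * N" if "cmod z < 1" for z
    using mult_mono[OF M(2)[OF that] N(2)[OF that] M(1)] by (simp add: norm_mult)
  then have "bounded ((\<lambda>z. g z * f z) ` disk)"
    by (intro boundedI[of _ "M * N"]) auto
  moreover have "(\<lambda>z. g z * f z) holomorphic_on disk"
    using assms by (intro holomorphic_intros) (auto simp: hardy_infinity_def)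
  ultimately show ?thesis by (simp add: hardy_infinity_def)
qed

lemma hardy_infinity_subset_hardy2: "g \<in> hardy_infinity \<Longrightarrow> g \<in> hardy2"
  using hardy_infinity_mult_hardy2[OF _ one_hardy2(1), of g] by simp

section \<open>The isometry attached to a Pythagorean pair\<close>

text \<open>The defect \<open>L\<close> between the two sides is the limit of circle integrals of
  \<open>u * cnj v * W\<close>, where \<open>W\<close> tends to zero boundedly almost everywhere.
  Only \<open>u\<close> is assumed bounded because the identity is later applied with
  \<open>v = z ^ m / a\<close>.\<close>

lemma pythagorean_isometry:
  assumes ba: "pythagorean_pair b a" and u: "u \<in> hardy_infinity" and v: "v \<in> hardy2"
  shows "l2_inner (tcoeff (\<lambda>z. b z * u z)) (tcoeff (\<lambda>z. b z * v z)) +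
    l2_inner (tcoeff (\<lambda>z. a z * u z)) (tcoeff (\<lambda>z. a z * v z)) = l2_inner (tcoeff u) (tcoeff v)"
proof -
  define r where "r k = 1 - inverse (real (Suc k))" for k
  define p where "p k t = of_real (r k) * cis t" for k t
  have r: "0 \<le> r k" "r k < 1" for k
    by (auto simp: r_def field_simps)
  have p: "cmod (p k t) < 1" for k t
    using r[of k] by (simp add: p_def norm_mult)
  have b: "b \<in> hardy_infinity" and a: "a \<in> hardy_infinity"
    using ba by (auto simp: pythagorean_pair_def)
  have hol: "b holomorphic_on disk" "a holomorphic_on disk" "u holomorphic_on disk" "v holomorphic_on disk"
    using a b u v by (auto simp: hardy2_def hardy_infinity_def)
  have cont: "continuous_on {0..2 * pi} (\<lambda>t. b (p k t))" "continuous_on {0..2 * pi} (\<lambda>t. a (p k t))"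
    "continuous_on {0..2 * pi} (\<lambda>t. u (p k t))" "continuous_on {0..2 * pi} (\<lambda>t. v (p k t))" for k
    unfolding p_def using hol r by (auto intro!: continuous_on_circle)
  have u2: "u \<in> hardy2" using u by (rule hardy_infinity_subset_hardy2)
  define W where "W k t = (cmod (b (p k t)))\<^sup>2 + (cmod (a (p k t)))\<^sup>2 - 1" for k t
  have contW: "continuous_on {0..2 * pi} (W k)" for k
    unfolding W_def by (intro continuous_intros cont)
  define J where "J k = (LINT t|circle_measure. u (p k t) * cnj (v (p k t)) * of_real (W k t)) / (2 * pi)" for k
  define L where "L = l2_inner (tcoeff (\<lambda>z. b z * u z)) (tcoeff (\<lambda>z. b z * v z)) +
    l2_inner (tcoeff (\<lambda>z. a z * u z)) (tcoeff (\<lambda>z. a z * v z)) - l2_inner (tcoeff u) (tcoeff v)"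
  \<comment> \<open>\<open>J k\<close> collects three circle integrals, each converging to one of
    the inner products in \<open>L\<close>.\<close>
  have "J \<longlonglongrightarrow> L"
  proof -
    have "(\<lambda>k. (LINT t|circle_measure. b (p k t) * u (p k t) * cnj (b (p k t) * v (p k t))) / (2 * pi)
        + (LINT t|circle_measure. a (p k t) * u (p k t) * cnj (a (p k t) * v (p k t))) / (2 * pi)
        - (LINT t|circle_measure. u (p k t) * cnj (v (p k t))) / (2 * pi)) \<longlonglongrightarrow> L"
      unfolding L_def p_def r_def
      by (intro tendsto_intros circle_inner_tendsto hardy_infinity_mult_hardy2 a b u2 v)
    moreover have "(LINT t|circle_measure. b (p k t) * u (p k t) * cnj (b (p k t) * v (p k t))) / (2 * pi)
        + (LINT t|circle_measure. a (p k t) * u (p k t) * cnj (a (p k t) * v (p k t))) / (2 * pi)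
        - (LINT t|circle_measure. u (p k t) * cnj (v (p k t))) / (2 * pi) = J k" for k
    proof -
      have "u (p k t) * cnj (v (p k t)) * of_real (W k t) =
          b (p k t) * u (p k t) * cnj (b (p k t) * v (p k t))
          + a (p k t) * u (p k t) * cnj (a (p k t) * v (p k t)) - u (p k t) * cnj (v (p k t))" for t
        unfolding W_def of_real_add of_real_diff complex_norm_square by (simp add: algebra_simps)
      moreover have "integrable circle_measure (\<lambda>t. b (p k t) * u (p k t) * cnj (b (p k t) * v (p k t)))"
        "integrable circle_measure (\<lambda>t. a (p k t) * u (p k t) * cnj (a (p k t) * v (p k t)))"
        "integrable circle_measure (\<lambda>t. u (p k t) * cnj (v (p k t)))"
        by (intro integrable_circle continuous_intros cont)+
      ultimately show ?thesis
        unfolding J_def by (simp add: add_divide_distrib diff_divide_distrib del: complex_cnj_mult)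
    qed
    ultimately show ?thesis by simp
  qed
  define E where "E k = (LINT t|circle_measure. (cmod (u (p k t)) * W k t)\<^sup>2) / (2 * pi)" for k
  obtain U where U: "0 \<le> U" "\<And>z. cmod z < 1 \<Longrightarrow> cmod (u z) \<le> U"
    using hardy_infinity_bound[OF u] by blast
  obtain B where B: "0 \<le> B" "\<And>z. cmod z < 1 \<Longrightarrow> cmod (b z) \<le> B"
    using hardy_infinity_bound[OF b] by blast
  obtain A where A: "0 \<le> A" "\<And>z. cmod z < 1 \<Longrightarrow> cmod (a z) \<le> A"
    using hardy_infinity_bound[OF a] by blast
  have "(\<lambda>k. LINT t|circle_measure. (cmod (u (p k t)) * W k t)\<^sup>2) \<longlonglongrightarrow> (LINT t|circle_measure. 0)"
  proof (rule integral_dominated_convergence)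
    show "(\<lambda>t. (cmod (u (p k t)) * W k t)\<^sup>2) \<in> borel_measurable circle_measure" for k
      by (intro borel_measurable_integrable integrable_circle continuous_intros cont contW)
    show "integrable circle_measure (\<lambda>_. (U * (B\<^sup>2 + A\<^sup>2 + 1))\<^sup>2)"
      by (intro integrable_circle continuous_intros)
    show "AE t in circle_measure. norm ((cmod (u (p k t)) * W k t)\<^sup>2) \<le> (U * (B\<^sup>2 + A\<^sup>2 + 1))\<^sup>2" for k
    proof (rule AE_I2)
      fix t
      have "(cmod (b (p k t)))\<^sup>2 \<le> B\<^sup>2" "(cmod (a (p k t)))\<^sup>2 \<le> A\<^sup>2"
        using A B p by (auto intro!: power_mono)
      then have "\<bar>W k t\<bar> \<le> B\<^sup>2 + A\<^sup>2 + 1"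
        unfolding W_def abs_le_iff using zero_le_power2[of "cmod (b (p k t))"] zero_le_power2[of "cmod (a (p k t))"]
        by linarith
      then have "\<bar>cmod (u (p k t)) * W k t\<bar> \<le> U * (B\<^sup>2 + A\<^sup>2 + 1)"
        unfolding abs_mult using U p by (intro mult_mono) auto
      from power_mono[OF this, of 2] show "norm ((cmod (u (p k t)) * W k t)\<^sup>2) \<le> (U * (B\<^sup>2 + A\<^sup>2 + 1))\<^sup>2"
        by simp
    qed
    \<comment> \<open>Boundary values are limits along \<open>at_left 1\<close>; the radii stay
      strictly below one, so these limits may be taken along the sequence \<open>r\<close>.\<close>
    have radial: "filterlim r (at_left 1) sequentially"
      unfolding filterlim_at using r radii_tendsto unfolding r_def[abs_def, symmetric] by (auto simp: less_imp_neq)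
    have "AE t in circle_measure. \<exists>\<beta> \<alpha>. has_boundary_value b (cis t) \<beta> \<and> has_boundary_value a (cis t) \<alpha> \<and>
        (cmod \<beta>)\<^sup>2 + (cmod \<alpha>)\<^sup>2 = 1"
      using ba by (auto simp: pythagorean_pair_def)
    then show "AE t in circle_measure. (\<lambda>k. (cmod (u (p k t)) * W k t)\<^sup>2) \<longlonglongrightarrow> 0"
    proof eventually_elim
      case (elim t)
      then obtain \<beta> \<alpha> where \<beta>: "((\<lambda>r. b (of_real r * cis t)) \<longlongrightarrow> \<beta>) (at_left 1)"
        and \<alpha>: "((\<lambda>r. a (of_real r * cis t)) \<longlongrightarrow> \<alpha>) (at_left 1)"
        and 1: "(cmod \<beta>)\<^sup>2 + (cmod \<alpha>)\<^sup>2 = 1"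
        by (auto simp: has_boundary_value_def)
      have "(\<lambda>k. W k t) \<longlonglongrightarrow> (cmod \<beta>)\<^sup>2 + (cmod \<alpha>)\<^sup>2 - 1"
        unfolding W_def p_def
        by (intro tendsto_intros filterlim_compose[OF \<beta> radial] filterlim_compose[OF \<alpha> radial])
      then have W0: "(\<lambda>k. (U * W k t)\<^sup>2) \<longlonglongrightarrow> 0"
        using tendsto_power[OF tendsto_mult_right_zero, of "\<lambda>k. W k t" sequentially U 2] 1 by simp
      show ?case
      proof (rule Lim_null_comparison[OF _ W0])
        show "\<forall>\<^sub>F k in sequentially. norm ((cmod (u (p k t)) * W k t)\<^sup>2) \<le> (U * W k t)\<^sup>2"
        proof (intro always_eventually allI)
          fix k
          have "(cmod (u (p k t)))\<^sup>2 * (W k t)\<^sup>2 \<le> U\<^sup>2 * (W k t)\<^sup>2"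
            using U p by (intro mult_right_mono power_mono) auto
          then show "norm ((cmod (u (p k t)) * W k t)\<^sup>2) \<le> (U * W k t)\<^sup>2"
            by (simp add: power_mult_distrib)
        qed
      qed
    qed
  qed simp
  then have E: "E \<longlonglongrightarrow> 0"
    unfolding E_def by (auto intro!: tendsto_divide_zero)
  define V where "V = (l2_norm (tcoeff v))\<^sup>2"
  have "cmod L \<le> d * V" if d: "0 < d" for d
  proof -
    \<comment> \<open>AM-GM with weight \<open>d\<close> separates \<open>v\<close>, which is bounded only in mean square, from \<open>u W\<close>,
      which tends to \<open>0\<close> boundedly.\<close>
    have bound: "cmod (J k) \<le> d * V + E k / d" for k
    proof -
      have "cmod (LINT t|circle_measure. u (p k t) * cnj (v (p k t)) * of_real (W k t))
          \<le> (LINT t|circle_measure. d * (cmod (v (p k t)))\<^sup>2 + (cmod (u (p k t)) * W k t)\<^sup>2 / d)"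
      proof (rule order_trans[OF integral_norm_bound integral_mono])
        fix t
        have "2 * (d * cmod (v (p k t))) * (cmod (u (p k t)) * \<bar>W k t\<bar>)
            \<le> (d * cmod (v (p k t)))\<^sup>2 + (cmod (u (p k t)) * \<bar>W k t\<bar>)\<^sup>2"
          by (rule sum_squares_bound)
        moreover have "0 \<le> d * cmod (v (p k t)) * (cmod (u (p k t)) * \<bar>W k t\<bar>)"
          using d by simp
        ultimately have "d * (cmod (v (p k t)) * (cmod (u (p k t)) * \<bar>W k t\<bar>))
            \<le> (d * cmod (v (p k t)))\<^sup>2 + (cmod (u (p k t)) * \<bar>W k t\<bar>)\<^sup>2"
          by linarith
        then show "norm (u (p k t) * cnj (v (p k t)) * of_real (W k t))
            \<le> d * (cmod (v (p k t)))\<^sup>2 + (cmod (u (p k t)) * W k t)\<^sup>2 / d"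
          using d by (simp add: norm_mult power_mult_distrib field_simps power2_eq_square)
      qed (intro integrable_circle continuous_intros cont contW; use d in simp)+
      also have "\<dots> = d * (LINT t|circle_measure. (cmod (v (p k t)))\<^sup>2)
          + (LINT t|circle_measure. (cmod (u (p k t)) * W k t)\<^sup>2) / d"
        by (subst Bochner_Integration.integral_add)
          (use d in \<open>auto intro!: integrable_circle continuous_intros cont contW\<close>)
      finally have "cmod (J k) \<le> d * circle_mean v (r k) + E k / d"
        unfolding J_def E_def circle_mean_def p_def[symmetric] using d
        by (simp add: norm_divide field_simps)
      also have "\<dots> \<le> d * V + E k / d"
        using circle_mean_le[OF hol(4) r, of k] v d by (simp add: V_def hardy2_iff)
      finally show ?thesis .
    qed
    have "(\<lambda>k. d * V + E k / d) \<longlonglongrightarrow> d * V + 0 / d"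
      using d by (intro tendsto_intros E) auto
    from LIMSEQ_le[OF tendsto_norm[OF \<open>J \<longlonglongrightarrow> L\<close>] this] bound show ?thesis by auto
  qed
  \<comment> \<open>Unless \<open>L = 0\<close>, this choice of \<open>d\<close> gives
    \<open>|L| * (V + 1) \<le> |L| * V\<close>, which is absurd.\<close>
  from this[of "cmod L / (V + 1)"] have "L = 0"
  proof (rule_tac ccontr)
    assume *: "0 < cmod L / (V + 1) \<Longrightarrow> cmod L \<le> cmod L / (V + 1) * V" and "L \<noteq> 0"
    have "0 \<le> V" by (simp add: V_def)
    with \<open>L \<noteq> 0\<close> * have "cmod L * (V + 1) \<le> cmod L * V" by (simp add: field_simps)
    with \<open>L \<noteq> 0\<close> show False by (simp add: distrib_left)
  qed
  then show ?thesis by (simp add: L_def)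
qed

section \<open>Herglotz integrals\<close>

text \<open>The Herglotz integral without its normalization: the exponent in \<open>outer\<close> is
  this function at \<open>ln k\<close>, divided by \<open>2 * pi\<close>.\<close>

definition herglotz :: "(real \<Rightarrow> real) \<Rightarrow> complex \<Rightarrow> complex" where
  "herglotz u z = (LINT t|circle_measure. (cis t + z) / (cis t - z) * of_real (u t))"

text \<open>With \<open>w = z * cnj (cis t)\<close> the kernel is
  \<open>(1 + w) / (1 - w) = 2 / (1 - w) - 1\<close>, a geometric series whose zeroth term is
  halved.\<close>

lemma herglotz_kernel_sums:
  assumes "cmod z < 1"
  shows "(\<lambda>n. (if n = 0 then 1 else 2) * z ^ n * cnj (cis t ^ n)) sums ((cis t + z) / (cis t - z))"
proof -
  define w where "w = z * cnj (cis t)"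
  have w: "cmod w < 1" using assms by (simp add: w_def norm_mult)
  have nz: "cis t - z \<noteq> 0" "1 - w \<noteq> 0"
    using assms w by auto
  have "(\<lambda>n. 2 * w ^ n) sums (2 * (1 / (1 - w)))"
    by (intro sums_mult geometric_sums w)
  moreover have "(\<lambda>n. if n = 0 then 1 else 0) sums (1::complex)"
    using sums_single[of 0 "\<lambda>n. 1::complex"] by simp
  ultimately have "(\<lambda>n. 2 * w ^ n - (if n = 0 then 1 else 0)) sums (2 * (1 / (1 - w)) - 1)"
    by (rule sums_diff)
  moreover have "2 * w ^ n - (if n = 0 then 1 else 0) = (if n = 0 then 1 else 2) * z ^ n * cnj (cis t ^ n)" for n
    by (simp add: w_def power_mult_distrib)
  moreover have "2 * (1 / (1 - w)) - 1 = (cis t + z) / (cis t - z)"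
  proof -
    have "cis t * w = z" by (simp add: w_def cis_cnj cis_mult mult.left_commute[of _ z])
    then have "cis t + z = cis t * (1 + w)" "cis t - z = cis t * (1 - w)"
      by (simp_all add: algebra_simps)
    then show ?thesis using nz by (simp add: field_simps)
  qed
  ultimately show ?thesis by simp
qed

text \<open>The kernel series is dominated by a geometric series times \<open>|u|\<close>, so it
  integrates term by term. The resulting power series makes the integral holomorphic without
  differentiation under the integral sign.\<close>

lemma herglotz_sums:
  assumes u: "integrable circle_measure u" and z: "cmod z < 1"
  shows "integrable circle_measure (\<lambda>t. (cis t + z) / (cis t - z) * of_real (u t))"
    and "(\<lambda>n. (if n = 0 then 1 else 2) * (LINT t|circle_measure. cnj (cis t ^ n) * of_real (u t)) * z ^ n)
      sums herglotz u z"
proof -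
  define h where "h n t = (if n = 0 then 1 else 2) * z ^ n * (cnj (cis t ^ n) * of_real (u t))" for n t
  have uabs: "integrable circle_measure (\<lambda>t. \<bar>u t\<bar>)" using u by simp
  have sum: "(\<Sum>n. h n t) = (cis t + z) / (cis t - z) * of_real (u t)" for t
    using sums_unique[OF sums_mult2[OF herglotz_kernel_sums[OF z, of t], of "of_real (u t)"]]
    by (simp add: h_def mult.assoc)
  have norm_h: "norm (h n t) = (if n = 0 then 1 else 2) * cmod z ^ n * \<bar>u t\<bar>" for n t
    by (simp add: h_def norm_mult norm_power)
  have "summable (\<lambda>n. 2 * cmod z ^ n)"
    using z by (intro summable_mult summable_geometric) simp
  then have *: "summable (\<lambda>n. (if n = 0 then 1 else 2) * cmod z ^ n)"
    by (rule summable_comparison_test') simp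
  have meas: "(\<lambda>t. cnj (cis t ^ n) * of_real (u t)) \<in> borel_measurable circle_measure" for n
  proof (rule borel_measurable_times)
    show "(\<lambda>t. cnj (cis t ^ n)) \<in> borel_measurable circle_measure"
      by (intro borel_measurable_integrable integrable_circle continuous_intros)
    show "(\<lambda>t. complex_of_real (u t)) \<in> borel_measurable circle_measure"
      using borel_measurable_integrable[OF u] by measurable
  qed
  have int0: "integrable circle_measure (\<lambda>t. cnj (cis t ^ n) * of_real (u t))" for n
    by (rule Bochner_Integration.integrable_bound[OF u meas]) (simp add: norm_mult norm_power)
  have int: "integrable circle_measure (h n)" for n
    unfolding h_def by (intro integrable_mult_right int0)
  have s1: "AE t in circle_measure. summable (\<lambda>n. norm (h n t))"
    unfolding norm_h by (intro AE_I2 summable_mult2 *)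
  have s2: "summable (\<lambda>n. LINT t|circle_measure. norm (h n t))"
    unfolding norm_h integral_mult_right_zero by (intro summable_mult2 *)
  show "integrable circle_measure (\<lambda>t. (cis t + z) / (cis t - z) * of_real (u t))"
    using integrable_suminf[OF int s1 s2] by (simp add: sum)
  have "(\<lambda>n. LINT t|circle_measure. h n t) sums herglotz u z"
    using sums_integral[OF int s1 s2] by (simp add: sum herglotz_def)
  then show "(\<lambda>n. (if n = 0 then 1 else 2) * (LINT t|circle_measure. cnj (cis t ^ n) * of_real (u t)) * z ^ n)
      sums herglotz u z"
    unfolding h_def integral_mult_right_zero by (simp add: mult_ac)
qed

lemma herglotz_holomorphic: "integrable circle_measure u \<Longrightarrow> herglotz u holomorphic_on disk"
  by (rule tcoeffI(1)) (rule herglotz_sums(2))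

text \<open>Only the zeroth Fourier coefficient of a constant is nonzero. This evaluates the
  constant weight against which truncated weights are compared.\<close>

lemma herglotz_const:
  assumes "cmod z < 1"
  shows "herglotz (\<lambda>_. c) z = 2 * pi * c"
proof -
  have int: "integrable circle_measure (\<lambda>_. c)" by (intro integrable_circle continuous_intros)
  have "(LINT t|circle_measure. cnj (cis t ^ n) * of_real c) = (if n = 0 then 2 * pi * c else 0)" for n
  proof -
    have "(LINT t|circle_measure. cnj (cis t ^ n)) = (if n = 0 then 2 * pi else 0)"
      using integral_cis_power[of 0 n] by (simp only: power_0 mult_1_left eq_commute[of 0 n])
    then show ?thesis by (simp only: integral_mult_left_zero) simp
  qed
  then have "(\<lambda>n. (if n = 0 then 1 else 2) * complex_of_real (if n = 0 then 2 * pi * c else 0) * z ^ n)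
      sums herglotz (\<lambda>_. c) z"
    using herglotz_sums(2)[OF int assms] by (simp only:)
  moreover have "(\<lambda>n. (if n = 0 then 1 else 2) * complex_of_real (if n = 0 then 2 * pi * c else 0) * z ^ n)
      = (\<lambda>n. if n = 0 then 2 * pi * c else 0)"
    by auto
  moreover have "(\<lambda>n. complex_of_real (if n = 0 then 2 * pi * c else 0)) = (\<lambda>n::nat. if n = 0 then complex_of_real (2 * pi * c) else 0)"
    by auto
  ultimately have "(\<lambda>n::nat. if n = 0 then complex_of_real (2 * pi * c) else 0) sums herglotz (\<lambda>_. c) z"
    by (simp only:)
  from sums_unique2[OF this sums_single[of 0 "\<lambda>_. complex_of_real (2 * pi * c)"]]
  show ?thesis by simp
qed

text \<open>The real part is the Poisson kernel \<open>(1 - |z|^2) / |cis t - z|^2\<close>.\<close>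

lemma Poisson_kernel_nonneg:
  assumes "cmod z < 1"
  shows "0 \<le> Re ((cis t + z) / (cis t - z))"
proof -
  have "Re ((cis t + z) * cnj (cis t - z)) = 1 - (cmod z)\<^sup>2"
    unfolding cmod_power2 using sin_cos_squared_add2[of t]
    by (simp add: algebra_simps power2_eq_square)
  moreover have "(cmod z)\<^sup>2 \<le> 1" using assms by (simp add: power_le_one)
  ultimately show ?thesis
    unfolding complex_div_cnj[of "cis t + z"] by (simp add: Re_divide_of_real flip: of_real_power)
qed

lemma herglotz_mono:
  assumes "integrable circle_measure u" "integrable circle_measure v" "\<And>t. t \<in> {0..2 * pi} \<Longrightarrow> u t \<le> v t"
    and z: "cmod z < 1"
  shows "Re (herglotz u z) \<le> Re (herglotz v z)"
proof -
  note int = herglotz_sums(1)[OF assms(1) z] herglotz_sums(1)[OF assms(2) z]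
  have "(LINT t|circle_measure. Re ((cis t + z) / (cis t - z) * of_real (u t)))
      \<le> (LINT t|circle_measure. Re ((cis t + z) / (cis t - z) * of_real (v t)))"
  proof (rule integral_mono)
    fix t assume "t \<in> space circle_measure"
    then have "t \<in> {0..2 * pi}" by simp
    then show "Re ((cis t + z) / (cis t - z) * of_real (u t)) \<le> Re ((cis t + z) / (cis t - z) * of_real (v t))"
      using mult_left_mono[OF assms(3)[of t] Poisson_kernel_nonneg[OF z, of t]] by (simp only: Re_complex_of_real Im_complex_of_real times_complex.simps mult_zero_right diff_zero)
  qed (intro integrable_Re int)+
  then show ?thesis
    unfolding herglotz_def integral_Re[OF int(1)] integral_Re[OF int(2)] .
qed

section \<open>The reciprocal of the outer function\<close>

lemma pythagorean_inverse_hardy2: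
  assumes ba: "pythagorean_pair b a" and phi: "(\<lambda>z. b z / a z) \<in> hardy2"
  shows "(\<lambda>z. 1 / a z) \<in> hardy2" and "cmod z < 1 \<Longrightarrow> a z \<noteq> 0"
proof -
  have b: "b \<in> hardy_infinity" and a: "a \<in> hardy_infinity" and "outer a"
    using ba by (auto simp: pythagorean_pair_def)
  then obtain c k where c: "cmod c = 1" and ln_k: "integrable circle_measure (\<lambda>t. ln (k t))"
    and a_eq: "\<And>z. cmod z < 1 \<Longrightarrow> a z = c * exp ((1 / (2 * pi)) * herglotz (\<lambda>t. ln (k t)) z)"
    by (auto simp: outer_def herglotz_def)
  define u where "u t = ln (k t)" for t
  have u: "integrable circle_measure u" using ln_k by (simp add: u_def[abs_def])
  have a_eq: "a z = c * exp ((1 / (2 * pi)) * herglotz u z)" if "cmod z < 1" for z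
    using a_eq[OF that] by (simp add: u_def[abs_def])
  show nz: "a z \<noteq> 0" if "cmod z < 1" for z
    using c a_eq[OF that] by auto
  have a_hol: "a holomorphic_on disk" and b_hol: "b holomorphic_on disk"
    using a b by (auto simp: hardy_infinity_def)
  have inv_hol: "(\<lambda>z. 1 / a z) holomorphic_on disk"
    using nz by (intro holomorphic_intros a_hol) auto
  \<comment> \<open>The truncated logarithm \<open>v n\<close> is at least \<open>u\<close> and at
    least \<open>- n\<close>. The first comparison gives \<open>|G n| \<le> 1 / |a|\<close>, the
    second makes \<open>G n\<close> bounded by \<open>exp n\<close>.\<close>
  define v where "v n t = max (u t) (- real n)" for n t
  have v: "integrable circle_measure (v n)" for n
    unfolding v_def by (intro integrable_max u integrable_circle continuous_intros)
  \<comment> \<open>The unimodular factor \<open>c\<close> is dropped, since only moduli are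
    compared.\<close>
  define G where "G n z = exp (- (1 / (2 * pi)) * herglotz (v n) z)" for n z
  have G_hol: "G n holomorphic_on disk" for n
    unfolding G_def by (intro holomorphic_intros herglotz_holomorphic v)
  have norm_G: "cmod (G n z) = exp (- Re (herglotz (v n) z) / (2 * pi))" for n z
    by (simp add: G_def)
  have norm_a: "1 / cmod (a z) = exp (- Re (herglotz u z) / (2 * pi))" if "cmod z < 1" for z
    using a_eq[OF that] c by (simp add: norm_mult exp_minus field_simps)
  have G_le: "cmod (G n z) \<le> 1 / cmod (a z)" if "cmod z < 1" for n z
    unfolding norm_G norm_a[OF that] using herglotz_mono[OF u v _ that, of n]
    by (simp add: v_def divide_right_mono)
  have G_bounded: "cmod (G n z) \<le> exp n" if "cmod z < 1" for n z
  proof -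
    have "Re (herglotz (\<lambda>_. - real n) z) \<le> Re (herglotz (v n) z)"
      by (intro herglotz_mono v that) (auto simp: v_def intro!: integrable_circle continuous_intros)
    then have "- Re (herglotz (v n) z) \<le> real n * (2 * pi)"
      by (simp add: herglotz_const[OF that] mult.commute)
    then show ?thesis unfolding norm_G by (simp add: field_simps)
  qed
  have G_inf: "G n \<in> hardy_infinity" for n
    unfolding hardy_infinity_def using G_hol G_bounded by (auto intro!: boundedI[of _ "exp n"])
  \<comment> \<open>The summands bound the squared norms of \<open>b * G n\<close>, dominated by
    \<open>b / a\<close>, and of \<open>a * G n\<close>, dominated by \<open>1\<close>.\<close>
  define C where "C = sqrt ((l2_norm (tcoeff (\<lambda>z. b z / a z)))\<^sup>2 + 1)"
  have C: "0 \<le> C" "C\<^sup>2 = (l2_norm (tcoeff (\<lambda>z. b z / a z)))\<^sup>2 + 1"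
    by (auto simp: C_def)
  have G_norm: "(l2_norm (tcoeff (G n)))\<^sup>2 \<le> C\<^sup>2" for n
  proof -
    have G2: "G n \<in> hardy2" by (intro hardy_infinity_subset_hardy2 G_inf)
    have "cmod (b z * G n z) \<le> 1 * cmod (b z / a z)" if "cmod z < 1" for z
      using mult_left_mono[OF G_le[OF that, of n], of "cmod (b z)"] by (simp add: norm_mult norm_divide)
    note b1 = hardy2_dominated[OF holomorphic_on_mult[OF b_hol G_hol[of n]] phi zero_le_one this]
    have "cmod (a z * G n z) \<le> 1 * cmod 1" if "cmod z < 1" for z
      using mult_left_mono[OF G_le[OF that, of n], of "cmod (a z)"] nz[OF that] by (simp add: norm_mult)
    note a1 = hardy2_dominated[OF holomorphic_on_mult[OF a_hol G_hol[of n]] one_hardy2(1) zero_le_one this]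
    have "l2_norm (tcoeff (\<lambda>_. 1)) = 1"
      unfolding l2_norm_def one_hardy2(2) using suminf_finite[of "{0}" "\<lambda>n::nat. (cmod (if n = 0 then 1 else 0))\<^sup>2"] by simp
    have "complex_of_real ((l2_norm (tcoeff (G n)))\<^sup>2) =
        of_real ((l2_norm (tcoeff (\<lambda>z. b z * G n z)))\<^sup>2 + (l2_norm (tcoeff (\<lambda>z. a z * G n z)))\<^sup>2)"
      using pythagorean_isometry[OF ba G_inf G2, of n] G2 a1(1) b1(1)
      by (simp add: l2_inner_self hardy2_iff)
    then have "(l2_norm (tcoeff (G n)))\<^sup>2 =
        (l2_norm (tcoeff (\<lambda>z. b z * G n z)))\<^sup>2 + (l2_norm (tcoeff (\<lambda>z. a z * G n z)))\<^sup>2"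
      using of_real_eq_iff by blast
    also have "\<dots> \<le> (l2_norm (tcoeff (\<lambda>z. b z / a z)))\<^sup>2 + 1\<^sup>2"
      using a1 b1 \<open>l2_norm (tcoeff (\<lambda>_. 1)) = 1\<close> by (intro add_mono power_mono) (auto simp: hardy2_iff)
    finally show ?thesis by (simp add: C)
  qed
  have G_lim: "(\<lambda>n. cmod (G n z)) \<longlonglongrightarrow> 1 / cmod (a z)" if z: "cmod z < 1" for z
  proof -
    \<comment> \<open>Truncation from below at a nonpositive level never increases the absolute
      value, so the integrand with \<open>u\<close> dominates; for each \<open>t\<close> the
      sequence \<open>v n t\<close> is eventually equal to \<open>u t\<close>.\<close>
    have "(\<lambda>n. herglotz (v n) z) \<longlonglongrightarrow> herglotz u z"
      unfolding herglotz_def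
    proof (rule integral_dominated_convergence)
      show "integrable circle_measure (\<lambda>t. cmod ((cis t + z) / (cis t - z) * of_real (u t)))"
        by (intro integrable_norm herglotz_sums u z)
      show "AE t in circle_measure. (\<lambda>n. (cis t + z) / (cis t - z) * of_real (v n t))
          \<longlonglongrightarrow> (cis t + z) / (cis t - z) * of_real (u t)"
      proof (rule AE_I2)
        fix t
        obtain N :: nat where N: "- u t \<le> real N" using real_arch_simple by blast
        have "\<forall>\<^sub>F n in sequentially. v n t = u t"
          using eventually_ge_at_top[of N] by eventually_elim (use N in \<open>auto simp: v_def\<close>)
        then have "(\<lambda>n. v n t) \<longlonglongrightarrow> u t" by (rule tendsto_eventually)
        then show "(\<lambda>n. (cis t + z) / (cis t - z) * of_real (v n t)) \<longlonglongrightarrow> (cis t + z) / (cis t - z) * of_real (u t)"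
          by (intro tendsto_intros)
      qed
      show "AE t in circle_measure. norm ((cis t + z) / (cis t - z) * of_real (v n t))
          \<le> cmod ((cis t + z) / (cis t - z) * of_real (u t))" for n
        unfolding norm_mult by (intro AE_I2 mult_left_mono) (auto simp: v_def)
    qed (intro borel_measurable_integrable herglotz_sums u v z)+
    then show ?thesis
      unfolding norm_G norm_a[OF z] by (intro tendsto_intros) auto
  qed
  \<comment> \<open>On a fixed circle \<open>1 / a\<close> is continuous and dominates every
    \<open>G n\<close>, so the uniform bound on the means of \<open>G n\<close> passes to
    \<open>1 / a\<close>.\<close>
  have "circle_mean (\<lambda>z. 1 / a z) r \<le> C\<^sup>2" if r: "0 \<le> r" "r < 1" for r
  proof -
    have p: "cmod (of_real r * cis t) < 1" for t
      using r by (simp add: norm_mult)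
    have "(\<lambda>n. LINT t|circle_measure. (cmod (G n (of_real r * cis t)))\<^sup>2) \<longlonglongrightarrow>
        (LINT t|circle_measure. (cmod (1 / a (of_real r * cis t)))\<^sup>2)"
    proof (rule integral_dominated_convergence)
      show "integrable circle_measure (\<lambda>t. (cmod (1 / a (of_real r * cis t)))\<^sup>2)"
        by (intro integrable_circle continuous_intros continuous_on_circle[OF inv_hol r])
      then show "(\<lambda>t. (cmod (1 / a (of_real r * cis t)))\<^sup>2) \<in> borel_measurable circle_measure"
        by simp
      show "(\<lambda>t. (cmod (G n (of_real r * cis t)))\<^sup>2) \<in> borel_measurable circle_measure" for n
        by (intro borel_measurable_integrable integrable_circle continuous_intros continuous_on_circle[OF G_hol r])
      show "AE t in circle_measure. (\<lambda>n. (cmod (G n (of_real r * cis t)))\<^sup>2) \<longlonglongrightarrow> (cmod (1 / a (of_real r * cis t)))\<^sup>2"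
        by (intro AE_I2 tendsto_power) (use G_lim[OF p] in \<open>simp add: norm_divide\<close>)
      show "AE t in circle_measure. norm ((cmod (G n (of_real r * cis t)))\<^sup>2) \<le> (cmod (1 / a (of_real r * cis t)))\<^sup>2" for n
        using G_le[OF p] by (auto intro!: power_mono simp: norm_divide)
    qed
    then have "(\<lambda>n. circle_mean (G n) r) \<longlonglongrightarrow> circle_mean (\<lambda>z. 1 / a z) r"
      unfolding circle_mean_def by (intro tendsto_intros) auto
    moreover have "circle_mean (G n) r \<le> C\<^sup>2" for n
    proof -
      have "square_summable (tcoeff (G n))"
        using hardy_infinity_subset_hardy2[OF G_inf, of n] by (simp add: hardy2_iff)
      from order_trans[OF circle_mean_le[OF G_hol r this] G_norm] show ?thesis .
    qed
    ultimately show ?thesis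
      by (intro LIMSEQ_le_const2) auto
  qed
  from circle_mean_bounded(1)[OF inv_hol C(1) this] show "(\<lambda>z. 1 / a z) \<in> hardy2"
    using inv_hol by (simp add: hardy2_iff)
qed

section \<open>The co-analytic Toeplitz operator\<close>

text \<open>On Taylor coefficients this is multiplication by \<open>z ^ m\<close>.\<close>

definition shift_right :: "nat \<Rightarrow> (nat \<Rightarrow> complex) \<Rightarrow> nat \<Rightarrow> complex" where
  "shift_right m p j = (if m \<le> j then p (j - m) else 0)"

text \<open>The operator \<open>T\<close> on coefficient sequences. For square-summable
  \<open>p\<close> and \<open>x\<close> every entry is a convergent sum, but the resulting sequence
  need not be square-summable.\<close>

definition correlation :: "(nat \<Rightarrow> complex) \<Rightarrow> (nat \<Rightarrow> complex) \<Rightarrow> nat \<Rightarrow> complex" where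
  "correlation p x m = (\<Sum>n. cnj (p n) * x (m + n))"

lemma square_summable_shift_right:
  "square_summable p \<Longrightarrow> square_summable (shift_right m p)"
  using square_summable_shift[of "shift_right m p" m] by (simp add: shift_right_def)

text \<open>Each entry becomes a bounded linear functional of \<open>x\<close>; linearity of
  \<open>T\<close> and its closedness both rest on this.\<close>

lemma correlation_eq_inner:
  assumes x: "square_summable x" and p: "square_summable p"
  shows "correlation p x m = l2_inner x (shift_right m p)"
proof -
  have "l2_inner x (shift_right m p) = (\<Sum>n. x (n + m) * cnj (shift_right m p (n + m)))
      + (\<Sum>n<m. x n * cnj (shift_right m p n))"
    unfolding l2_inner_def
    by (rule suminf_split_initial_segment[OF summable_l2_inner[OF x square_summable_shift_right[OF p]]])
  then show ?thesis
    by (simp add: correlation_def shift_right_def mult.commute add.commute)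
qed

lemma correlation_add:
  assumes "square_summable x" "square_summable y" "square_summable p"
  shows "correlation p (\<lambda>n. x n + y n) = (\<lambda>m. correlation p x m + correlation p y m)"
  by (simp add: fun_eq_iff correlation_eq_inner square_summable_add assms l2_inner_add_left
      square_summable_shift_right)

lemma correlation_diff:
  assumes "square_summable x" "square_summable y" "square_summable p"
  shows "correlation p (\<lambda>n. x n - y n) = (\<lambda>m. correlation p x m - correlation p y m)"
  by (simp add: fun_eq_iff correlation_eq_inner square_summable_diff assms l2_inner_diff_left
      square_summable_shift_right)

lemma correlation_scale:
  assumes "square_summable x" "square_summable p"
  shows "correlation p (\<lambda>n. c * x n) = (\<lambda>m. c * correlation p x m)"
  by (simp add: fun_eq_iff correlation_eq_inner square_summable_scale assms l2_inner_scale_left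
      square_summable_shift_right)

lemma correlation_zero [simp]: "correlation p (\<lambda>_. 0) = (\<lambda>_. 0)"
  by (simp add: fun_eq_iff correlation_def)

lemma norm_dilate_less_one: "0 \<le> r \<Longrightarrow> r \<le> 1 \<Longrightarrow> cmod z < 1 \<Longrightarrow> cmod (of_real r * z) < 1"
  using mult_left_le_one_le[of "cmod z" r] by (simp add: norm_mult)

section \<open>The adjoint identity\<close>

text \<open>For \<open>r < 1\<close> the coefficients of the dilation of \<open>g\<close> are
  absolutely summable, so its Taylor polynomials times \<open>\<phi>\<close> converge in norm. The
  identity therefore holds without any assumption that \<open>T f\<close> is
  square-summable.\<close>

lemma correlation_dilated_sums:
  assumes phi: "\<phi> \<in> hardy2" and f: "f \<in> hardy2" and g: "g holomorphic_on disk"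
    and r: "0 \<le> r" "r < 1"
  shows "(\<lambda>m. cnj (of_real r ^ m * tcoeff g m) * correlation (tcoeff \<phi>) (tcoeff f) m)
    sums l2_inner (tcoeff f) (tcoeff (\<lambda>z. \<phi> z * g (of_real r * z)))"
proof -
  define c where "c m = of_real r ^ m * tcoeff g m" for m
  \<comment> \<open>\<open>D N\<close> is \<open>\<phi>\<close> times the Taylor remainder of the
    dilated \<open>g\<close>; the case \<open>N = 0\<close> is the full product.\<close>
  define D where "D N z = \<phi> z * (g (of_real r * z) - (\<Sum>m<N. c m * z ^ m))" for N z
  have sq: "square_summable (tcoeff \<phi>)" "square_summable (tcoeff f)"
    and phi_hol: "\<phi> holomorphic_on disk"
    using phi f by (auto simp: hardy2_iff)
  have gr: "(\<lambda>z. g (of_real r * z)) holomorphic_on disk"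
  proof (rule holomorphic_on_compose_gen[OF _ g, unfolded o_def])
    show "(*) (complex_of_real r) ` disk \<subseteq> disk"
      using norm_dilate_less_one[OF r(1) less_imp_le[OF r(2)]] by auto
  qed (intro holomorphic_intros)
  have D_hol: "D N holomorphic_on disk" for N
    unfolding D_def by (intro holomorphic_intros phi_hol gr)
  have c: "summable (\<lambda>m. cmod (c m))"
    using tcoeff_summable_norm[OF g r] r by (simp add: c_def norm_mult norm_power mult.commute)
  \<comment> \<open>The tail of the absolute series bounds the Taylor remainder uniformly on the
    disk.\<close>
  define e where "e N = (\<Sum>m. cmod (c m)) - (\<Sum>m<N. cmod (c m))" for N
  have e0: "0 \<le> e N" for N
    unfolding e_def using sum_le_suminf[OF c, of "{..<N}"] by simp
  have e: "e \<longlonglongrightarrow> 0"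
    unfolding e_def using tendsto_diff[OF tendsto_const summable_LIMSEQ[OF c], of "suminf (\<lambda>m. cmod (c m))"] by simp
  have D_le: "cmod (D N z) \<le> e N * cmod (\<phi> z)" if z: "cmod z < 1" for N z
  proof -
    have gz: "(\<lambda>m. c m * z ^ m) sums g (of_real r * z)"
    proof -
      have "tcoeff (\<lambda>z. g (of_real r * z)) = c"
        unfolding c_def[abs_def] using r by (intro tcoeff_dilate g) simp
      from fun_cong[OF this] show ?thesis
        using tcoeff_sums[OF gr z] by (simp only:)
    qed
    have le: "cmod (c m * z ^ m) \<le> cmod (c m)" for m
      using z by (simp add: norm_mult norm_power power_le_one mult_right_le_one_le)
    have "summable (\<lambda>m. cmod (c (m + N)))" using c by (rule summable_ignore_initial_segment)
    moreover have "g (of_real r * z) - (\<Sum>m<N. c m * z ^ m) = (\<Sum>m. c (m + N) * z ^ (m + N))"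
      using suminf_minus_initial_segment[of "\<lambda>m. c m * z ^ m" N] gz by (simp add: sums_iff)
    ultimately have "cmod (g (of_real r * z) - (\<Sum>m<N. c m * z ^ m)) \<le> (\<Sum>m. cmod (c (m + N)))"
      using norm_suminf_le[of "\<lambda>m. c (m + N) * z ^ (m + N)" "\<lambda>m. cmod (c (m + N))"] le by simp
    also have "\<dots> = e N"
      unfolding e_def by (rule suminf_minus_initial_segment[OF c])
    finally show ?thesis
      unfolding D_def norm_mult mult.commute[of "cmod (\<phi> z)"] by (rule mult_right_mono) simp
  qed
  note D = hardy2_dominated[OF D_hol phi e0 D_le]
  \<comment> \<open>Passing from \<open>N\<close> to \<open>Suc N\<close> removes
    \<open>c N * z ^ N * \<phi>\<close>, whose pairing with \<open>f\<close> is one correlation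
    entry times \<open>cnj (c N)\<close>.\<close>
  have D_inner: "l2_inner (tcoeff f) (tcoeff (D N)) = l2_inner (tcoeff f) (tcoeff (D 0)) -
      (\<Sum>m<N. cnj (c m) * correlation (tcoeff \<phi>) (tcoeff f) m)" for N
  proof (induction N)
    case (Suc N)
    have s: "tcoeff (\<lambda>z. c N * (z ^ N * \<phi> z)) = (\<lambda>j. c N * shift_right N (tcoeff \<phi>) j)"
    proof -
      have "tcoeff (\<lambda>z. z ^ N * \<phi> z) j = shift_right N (tcoeff \<phi>) j" for j
        unfolding shift_right_def by (intro tcoeff_shift phi_hol)
      moreover have "(\<lambda>z. z ^ N * \<phi> z) holomorphic_on disk"
        by (intro holomorphic_intros phi_hol)
      note tcoeff_scale[OF this, of "c N"]
      ultimately show ?thesis by (simp only:)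
    qed
    have "D (Suc N) = (\<lambda>z. D N z - c N * (z ^ N * \<phi> z))"
      by (simp add: D_def fun_eq_iff algebra_simps)
    then have "tcoeff (D (Suc N)) = (\<lambda>j. tcoeff (D N) j - c N * shift_right N (tcoeff \<phi>) j)"
      using tcoeff_diff[OF D_hol[of N], of "\<lambda>z. c N * (z ^ N * \<phi> z)"]
      unfolding fun_cong[OF s] by (simp add: holomorphic_on_mult holomorphic_on_power holomorphic_on_const holomorphic_on_ident phi_hol)
    then have "l2_inner (tcoeff f) (tcoeff (D (Suc N))) =
        l2_inner (tcoeff f) (tcoeff (D N)) - cnj (c N) * l2_inner (tcoeff f) (shift_right N (tcoeff \<phi>))"
      using D(1)[of N] sq
        l2_inner_diff_right[of "tcoeff (D N)" "\<lambda>j. c N * shift_right N (tcoeff \<phi>) j" "tcoeff f"]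
        l2_inner_scale_right[of "tcoeff f" "shift_right N (tcoeff \<phi>)" "c N"]
      by (simp add: square_summable_scale square_summable_shift_right hardy2_iff)
    then show ?case
      unfolding Suc.IH correlation_eq_inner[OF sq(2,1)] by simp
  qed simp
  have "(\<lambda>N. l2_inner (tcoeff f) (tcoeff (D N))) \<longlonglongrightarrow> 0"
  proof (rule Lim_null_comparison)
    show "\<forall>\<^sub>F N in sequentially. norm (l2_inner (tcoeff f) (tcoeff (D N)))
        \<le> l2_norm (tcoeff f) * (e N * l2_norm (tcoeff \<phi>))"
    proof (intro always_eventually allI)
      fix N
      have "norm (l2_inner (tcoeff f) (tcoeff (D N))) \<le> l2_norm (tcoeff f) * l2_norm (tcoeff (D N))"
        using D(1)[of N] sq by (intro l2_Cauchy_Schwarz) (auto simp: hardy2_iff)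
      also have "\<dots> \<le> l2_norm (tcoeff f) * (e N * l2_norm (tcoeff \<phi>))"
        using sq by (intro mult_left_mono D(2)) auto
      finally show "norm (l2_inner (tcoeff f) (tcoeff (D N))) \<le> l2_norm (tcoeff f) * (e N * l2_norm (tcoeff \<phi>))" .
    qed
    show "(\<lambda>N. l2_norm (tcoeff f) * (e N * l2_norm (tcoeff \<phi>))) \<longlonglongrightarrow> 0"
      by (rule tendsto_mult_right_zero[OF tendsto_mult_left_zero[OF e]])
  qed
  moreover have "(\<Sum>m<N. cnj (c m) * correlation (tcoeff \<phi>) (tcoeff f) m) =
      l2_inner (tcoeff f) (tcoeff (D 0)) - l2_inner (tcoeff f) (tcoeff (D N))" for N
    using D_inner[of N] by (simp only: diff_diff_eq2 add_diff_cancel_left')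
  ultimately have "(\<lambda>N. \<Sum>m<N. cnj (c m) * correlation (tcoeff \<phi>) (tcoeff f) m) \<longlonglongrightarrow> l2_inner (tcoeff f) (tcoeff (D 0))"
    using tendsto_diff[OF tendsto_const, of "\<lambda>N. l2_inner (tcoeff f) (tcoeff (D N))" 0 sequentially "l2_inner (tcoeff f) (tcoeff (D 0))"]
    by (simp only: diff_zero)
  moreover have "D 0 = (\<lambda>z. \<phi> z * g (of_real r * z))" by (simp add: D_def fun_eq_iff)
  ultimately show ?thesis unfolding sums_def c_def by simp
qed

text \<open>The dilated identity is carried to radius one. The two sides need different arguments:
  weak convergence of \<open>\<phi>\<close> times the dilated \<open>g\<close>, and dominated
  convergence of the weighted sums.\<close>

lemma correlation_adjoint:
  assumes phi: "\<phi> \<in> hardy2" and f: "f \<in> hardy2" and g: "g \<in> hardy_infinity"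
    and T: "square_summable (correlation (tcoeff \<phi>) (tcoeff f))"
  shows "l2_inner (correlation (tcoeff \<phi>) (tcoeff f)) (tcoeff g) =
    l2_inner (tcoeff f) (tcoeff (\<lambda>z. \<phi> z * g z))"
proof -
  define r where "r k = 1 - inverse (real (Suc k))" for k
  have r: "0 \<le> r k" "r k < 1" "r k \<le> 1" for k
    by (auto simp: r_def field_simps)
  have r_lim: "r \<longlonglongrightarrow> 1" unfolding r_def by (rule radii_tendsto)
  obtain M where M: "0 \<le> M" "\<And>z. cmod z < 1 \<Longrightarrow> cmod (g z) \<le> M"
    using hardy_infinity_bound[OF g] by blast
  have g_hol: "g holomorphic_on disk" and phi_hol: "\<phi> holomorphic_on disk"
    using g phi by (auto simp: hardy_infinity_def hardy2_def)
  have sq: "square_summable (tcoeff \<phi>)" "square_summable (tcoeff f)" "square_summable (tcoeff g)"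
    using phi f hardy_infinity_subset_hardy2[OF g] by (auto simp: hardy2_iff)
  have ball: "cmod (of_real (r k) * z) < 1" if "cmod z < 1" for k z
    using r that by (intro norm_dilate_less_one)
  have gr: "(\<lambda>z. g (of_real (r k) * z)) holomorphic_on disk" for k
    by (rule holomorphic_on_compose_gen[OF _ g_hol, unfolded o_def])
      (use ball in \<open>auto intro!: holomorphic_intros\<close>)
  have hol: "(\<lambda>z. \<phi> z * g (of_real (r k) * z)) holomorphic_on disk" for k
    by (intro holomorphic_intros phi_hol gr)
  have le: "cmod (\<phi> z * g (of_real (r k) * z)) \<le> M * cmod (\<phi> z)" if "cmod z < 1" for k z
    using mult_left_mono[OF M(2)[OF ball[OF that, of k]], of "cmod (\<phi> z)"] by (simp add: norm_mult mult.commute)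
  note dom = hardy2_dominated[OF hol phi M(1) le]
  have gphi: "(\<lambda>z. \<phi> z * g z) \<in> hardy2"
    using hardy_infinity_mult_hardy2[OF g phi] by (simp add: mult.commute)
  \<comment> \<open>Boundedness of \<open>g\<close> gives the uniform norm bound
    \<open>M * l2_norm (tcoeff \<phi>)\<close>, and every coefficient of the product is a finite sum
    in which the radius may tend to one.\<close>
  have "(\<lambda>k. l2_inner (tcoeff f) (tcoeff (\<lambda>z. \<phi> z * g (of_real (r k) * z)))) \<longlonglongrightarrow>
      l2_inner (tcoeff f) (tcoeff (\<lambda>z. \<phi> z * g z))"
  proof (rule l2_weak_tendsto[OF sq(2)])
    fix n
    have "tcoeff (\<lambda>z. \<phi> z * g (of_real (r k) * z)) n =
        (\<Sum>i\<le>n. tcoeff \<phi> i * (of_real (r k) ^ (n - i) * tcoeff g (n - i)))" for k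
    proof -
      have "tcoeff (\<lambda>z. g (of_real (r k) * z)) = (\<lambda>n. of_real (r k) ^ n * tcoeff g n)"
        using r by (intro tcoeff_dilate g_hol) simp
      from fun_cong[OF this] show ?thesis
        using fun_cong[OF tcoeff_mult[OF phi_hol gr[of k]], of n] by (simp only:)
    qed
    moreover have "(\<lambda>k. \<Sum>i\<le>n. tcoeff \<phi> i * (of_real (r k) ^ (n - i) * tcoeff g (n - i))) \<longlonglongrightarrow>
        (\<Sum>i\<le>n. tcoeff \<phi> i * (of_real 1 ^ (n - i) * tcoeff g (n - i)))"
      by (intro tendsto_intros r_lim)
    moreover have "(\<Sum>i\<le>n. tcoeff \<phi> i * (of_real 1 ^ (n - i) * tcoeff g (n - i))) = tcoeff (\<lambda>z. \<phi> z * g z) n"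
      using fun_cong[OF tcoeff_mult[OF phi_hol g_hol], of n] by (simp only: of_real_1 power_one mult_1_left)
    ultimately show "(\<lambda>k. tcoeff (\<lambda>z. \<phi> z * g (of_real (r k) * z)) n) \<longlonglongrightarrow> tcoeff (\<lambda>z. \<phi> z * g z) n"
      by (simp only:)
  qed (use dom gphi in \<open>auto simp: hardy2_iff\<close>)
  moreover have eq: "l2_inner (tcoeff f) (tcoeff (\<lambda>z. \<phi> z * g (of_real (r k) * z))) =
      (\<Sum>m. correlation (tcoeff \<phi>) (tcoeff f) m * cnj (tcoeff g m) * of_real (r k ^ m))" for k
    using sums_unique[OF correlation_dilated_sums[OF phi f g_hol r(1,2)], of k]
    by (simp add: mult_ac)
  \<comment> \<open>Here square-summability of \<open>T f\<close> enters: it makes the unweighted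
    series absolutely convergent.\<close>
  moreover have "(\<lambda>k. \<Sum>m. correlation (tcoeff \<phi>) (tcoeff f) m * cnj (tcoeff g m) * of_real (r k ^ m)) \<longlonglongrightarrow>
      l2_inner (correlation (tcoeff \<phi>) (tcoeff f)) (tcoeff g)"
    unfolding l2_inner_def
    by (rule Abel_sum_tendsto[OF _ r(1,3) r_lim]) (simp add: norm_mult summable_norm_mult T sq)
  ultimately show ?thesis
    unfolding eq by (intro LIMSEQ_unique)
qed

section \<open>The de Branges--Rovnyak space\<close>

definition szego :: "complex \<Rightarrow> complex \<Rightarrow> complex" where
  "szego w z = 1 / (1 - cnj w * z)"

lemma szego_denominator:
  assumes "cmod w < 1" "cmod z < 1"
  shows "1 - cmod w \<le> cmod (1 - cnj w * z)"
proof -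
  have "cmod (cnj w * z) \<le> cmod w"
    using assms by (simp add: norm_mult mult_right_le_one_le)
  then show ?thesis
    using norm_triangle_ineq2[of 1 "cnj w * z"] by simp
qed

lemma szego:
  assumes w: "cmod w < 1"
  shows "tcoeff (szego w) = (\<lambda>n. cnj w ^ n)" "szego w \<in> hardy_infinity"
proof -
  have sums: "(\<lambda>n. cnj w ^ n * z ^ n) sums szego w z" if "cmod z < 1" for z
  proof -
    have "cmod (cnj w * z) < 1"
      using w that mult_left_le_one_le[of "cmod z" "cmod w"] by (simp add: norm_mult)
    from geometric_sums[OF this] show ?thesis by (simp add: szego_def power_mult_distrib)
  qed
  note c = tcoeffI[of "\<lambda>n. cnj w ^ n" "szego w", OF sums]
  show "tcoeff (szego w) = (\<lambda>n. cnj w ^ n)" by (rule c(2))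
  have "cmod (szego w z) \<le> 1 / (1 - cmod w)" if "cmod z < 1" for z
    unfolding szego_def norm_divide norm_one
    using w szego_denominator[OF w that] by (intro divide_left_mono mult_pos_pos) linarith+
  then have "bounded (szego w ` disk)"
    by (intro boundedI[of _ "1 / (1 - cmod w)"]) auto
  then show "szego w \<in> hardy_infinity"
    using c(1) by (simp add: hardy_infinity_def)
qed

lemma szego_reproducing:
  assumes "f \<in> hardy2" and w: "cmod w < 1"
  shows "l2_inner (tcoeff f) (tcoeff (szego w)) = f w"
  using tcoeff_sums[of f w] assms unfolding l2_inner_def fun_cong[OF szego(1)[OF w]]
  by (simp add: hardy2_iff sums_iff)

lemma tcoeff_diff_scale:
  assumes "f holomorphic_on disk" "g holomorphic_on disk"
  shows "tcoeff (\<lambda>z. f z - c * g z) = (\<lambda>n. tcoeff f n - c * tcoeff g n)"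
  by (rule tcoeffI)
    (use sums_diff[OF tcoeff_sums[OF assms(1)] sums_mult[OF tcoeff_sums[OF assms(2)]]]
      in \<open>simp add: left_diff_distrib mult.assoc\<close>)

lemma de_branges_rovnyak_kernel_szego:
  "de_branges_rovnyak_kernel b z w = szego w z - cnj (b w) * (b z * szego w z)"
  by (simp add: de_branges_rovnyak_kernel_def szego_def diff_divide_distrib)

text \<open>Szego kernels are eigenvectors of co-analytic Toeplitz operators:
  \<open>cnj w ^ m\<close> factors out of the sum and leaves the conjugated Taylor series of
  \<open>\<phi>\<close> at \<open>w\<close>.\<close>

lemma correlation_szego:
  assumes phi: "\<phi> \<in> hardy2" and w: "cmod w < 1"
  shows "correlation (tcoeff \<phi>) (tcoeff (szego w)) m = cnj (\<phi> w) * cnj w ^ m"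
proof -
  have "(\<lambda>n. tcoeff \<phi> n * w ^ n) sums \<phi> w"
    using phi w by (intro tcoeff_sums) (auto simp: hardy2_iff)
  then have "(\<lambda>n. cnj (tcoeff \<phi> n * w ^ n) * cnj w ^ m) sums (cnj (\<phi> w) * cnj w ^ m)"
    by (intro sums_mult2) (simp only: sums_cnj)
  then show ?thesis
    unfolding correlation_def fun_cong[OF szego(1)[OF w]]
    by (simp add: power_add sums_iff mult_ac)
qed

lemma tcoeff_power_mult:
  "f holomorphic_on disk \<Longrightarrow> tcoeff (\<lambda>z. z ^ m * f z) = shift_right m (tcoeff f)"
  unfolding fun_eq_iff shift_right_def by (intro allI tcoeff_shift)

lemma power_mult_hardy2: "f \<in> hardy2 \<Longrightarrow> (\<lambda>z. z ^ m * f z) \<in> hardy2"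
  unfolding hardy2_iff
  by (auto simp only: tcoeff_power_mult intro!: holomorphic_intros square_summable_shift_right)

lemma correlation_kernel:
  assumes ba: "pythagorean_pair b a" and phi: "(\<lambda>z. b z / a z) \<in> hardy2" and w: "cmod w < 1"
  shows "correlation (tcoeff (\<lambda>z. b z / a z)) (tcoeff (\<lambda>z. de_branges_rovnyak_kernel b z w))
    = (\<lambda>m. cnj (b w) * tcoeff (\<lambda>z. a z * szego w z) m)"
proof
  fix m
  define p where "p = tcoeff (\<lambda>z. b z / a z)"
  note inv = pythagorean_inverse_hardy2[OF ba phi]
  have b: "b \<in> hardy_infinity" and a: "a \<in> hardy_infinity"
    using ba by (auto simp: pythagorean_pair_def)
  have k2: "szego w \<in> hardy2" by (intro hardy_infinity_subset_hardy2 szego w)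
  have bk2: "(\<lambda>z. b z * szego w z) \<in> hardy2" by (intro hardy_infinity_mult_hardy2 b k2)
  have hol: "szego w holomorphic_on disk" "(\<lambda>z. b z * szego w z) holomorphic_on disk"
    "(\<lambda>z. b z / a z) holomorphic_on disk"
    using k2 bk2 phi by (auto simp: hardy2_iff)
  have sq: "square_summable p" "square_summable (tcoeff (szego w))" "square_summable (tcoeff (\<lambda>z. b z * szego w z))"
    using k2 bk2 phi by (auto simp: hardy2_iff p_def)
  \<comment> \<open>Pairing with this \<open>v\<close> extracts the entry of index \<open>m\<close>:
    \<open>b * v\<close> is \<open>z ^ m * (b / a)\<close>, which produces the correlation, and
    \<open>a * v\<close> is \<open>z ^ m\<close>.\<close>
  define v where "v z = z ^ m * (1 / a z)" for z
  have v2: "v \<in> hardy2" unfolding v_def[abs_def] by (intro power_mult_hardy2 inv(1))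
  have bv: "tcoeff (\<lambda>z. b z * v z) = shift_right m p"
  proof -
    have "tcoeff (\<lambda>z. z ^ m * (b z / a z)) = tcoeff (\<lambda>z. b z * v z)"
      by (rule tcoeff_cong[OF holomorphic_on_mult[OF holomorphic_on_power[OF holomorphic_on_ident] hol(3)]])
        (simp add: v_def)
    then show ?thesis unfolding tcoeff_power_mult[OF hol(3)] p_def ..
  qed
  have av: "tcoeff (\<lambda>z. a z * v z) = shift_right m (\<lambda>n. if n = 0 then 1 else 0)"
  proof -
    have "tcoeff (\<lambda>z. z ^ m * 1) = tcoeff (\<lambda>z. a z * v z)"
      by (rule tcoeff_cong) (use inv(2) in \<open>auto intro!: holomorphic_intros simp: v_def\<close>)
    moreover have "tcoeff (\<lambda>z. z ^ m * 1) = shift_right m (\<lambda>n. if n = 0 then 1 else 0)"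
      by (subst tcoeff_power_mult) (simp_all only: one_hardy2(2) holomorphic_on_const)
    ultimately show ?thesis by (simp only:)
  qed
  have "l2_inner x (shift_right m (\<lambda>n. if n = 0 then 1 else 0)) = x m" for x
  proof -
    have "(\<lambda>n. x n * cnj (shift_right m (\<lambda>n. if n = 0 then 1 else 0) n)) = (\<lambda>n. if n = m then x n else 0)"
      by (auto simp: shift_right_def)
    then show ?thesis
      unfolding l2_inner_def using sums_single[of m x] by (simp add: sums_iff)
  qed
  note ak = this[of "tcoeff (\<lambda>z. a z * szego w z)"]
  have "l2_inner (tcoeff (szego w)) (tcoeff v) = cnj (v w)"
    using l2_inner_commute[of "tcoeff (szego w)" "tcoeff v"] szego_reproducing[OF v2 w] sq v2
    by (simp add: hardy2_iff)
  then have Tbk: "correlation p (tcoeff (\<lambda>z. b z * szego w z)) m = cnj (v w) - tcoeff (\<lambda>z. a z * szego w z) m"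
    using pythagorean_isometry[OF ba szego(2)[OF w] v2]
    unfolding correlation_eq_inner[OF sq(3,1)] bv av ak by (simp add: algebra_simps)
  have "tcoeff (\<lambda>z. de_branges_rovnyak_kernel b z w) =
      (\<lambda>n. tcoeff (szego w) n - cnj (b w) * tcoeff (\<lambda>z. b z * szego w z) n)"
    unfolding de_branges_rovnyak_kernel_szego
    by (rule tcoeff_diff_scale[OF hol(1,2)])
  then have "correlation p (tcoeff (\<lambda>z. de_branges_rovnyak_kernel b z w)) m =
      correlation p (tcoeff (szego w)) m - cnj (b w) * correlation p (tcoeff (\<lambda>z. b z * szego w z)) m"
    using correlation_diff[OF sq(2) square_summable_scale[OF sq(3)] sq(1)] correlation_scale[OF sq(3,1)]
    by (simp only:)
  also have "correlation p (tcoeff (szego w)) m = cnj (b w / a w) * cnj w ^ m"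
    unfolding p_def by (rule correlation_szego[OF phi w])
  \<comment> \<open>The value \<open>v w = w ^ m / a w\<close> makes the
    \<open>T (b * szego w)\<close> term cancel the eigenvector term
    \<open>cnj (b w / a w) * cnj w ^ m\<close>, leaving only the coefficient of
    \<open>a * szego w\<close>.\<close>
  finally show "correlation (tcoeff (\<lambda>z. b z / a z)) (tcoeff (\<lambda>z. de_branges_rovnyak_kernel b z w)) m =
      cnj (b w) * tcoeff (\<lambda>z. a z * szego w z) m"
    unfolding Tbk by (simp add: v_def p_def algebra_simps)
qed

section \<open>The model space and its reproducing kernel\<close>

text \<open>The maximal domain of \<open>T\<close> in \<open>hardy2\<close>; \<open>model_ip\<close>
  is the inner product of the graph of \<open>T\<close>.\<close>

definition model_space :: "(complex \<Rightarrow> complex) \<Rightarrow> (complex \<Rightarrow> complex) set" where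
  "model_space \<phi> = {f \<in> hardy2. square_summable (correlation (tcoeff \<phi>) (tcoeff f))}"

definition model_ip :: "(complex \<Rightarrow> complex) \<Rightarrow> (complex \<Rightarrow> complex) \<Rightarrow> (complex \<Rightarrow> complex) \<Rightarrow> complex" where
  "model_ip \<phi> f g = l2_inner (tcoeff f) (tcoeff g) +
    l2_inner (correlation (tcoeff \<phi>) (tcoeff f)) (correlation (tcoeff \<phi>) (tcoeff g))"

lemma model_ip_self:
  assumes "f \<in> model_space \<phi>"
  shows "model_ip \<phi> f f =
    of_real ((l2_norm (tcoeff f))\<^sup>2 + (l2_norm (correlation (tcoeff \<phi>) (tcoeff f)))\<^sup>2)"
  using assms by (simp add: model_space_def model_ip_def hardy2_iff l2_inner_self)

text \<open>Square-summable coefficients are bounded, so a geometric series dominates. This turns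
  limits of coefficient sequences back into functions in the completeness proof.\<close>

lemma hardy2_of_coefficients:
  assumes y: "square_summable y"
  obtains f where "f \<in> hardy2" "tcoeff f = y"
proof -
  define f where "f z = (\<Sum>n. y n * z ^ n)" for z
  have "(\<lambda>n. y n * z ^ n) sums f z" if z: "cmod z < 1" for z
    unfolding f_def
  proof (intro summable_sums, rule summable_comparison_test')
    show "summable (\<lambda>n. l2_norm y * cmod z ^ n)"
      using z by (intro summable_mult summable_geometric) simp
    show "norm (y n * z ^ n) \<le> l2_norm y * cmod z ^ n" for n
      using component_le_l2_norm[OF y, of n] by (simp add: norm_mult norm_power mult_right_mono)
  qed
  note * = tcoeffI[of y f, OF this]
  show thesis
  proof (rule that)
    show "tcoeff f = y" by (rule *(2))
    show "f \<in> hardy2"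
      unfolding hardy2_iff using *(1) iffD2[OF arg_cong[OF *(2), of square_summable] y] by blast
  qed
qed

text \<open>The algebraic axioms are inherited from sequences; completeness rests on closedness of
  \<open>T\<close>, and the reproducing property on the adjoint identity.\<close>

lemma model_space_rkhs:
  assumes ba: "pythagorean_pair b a" and phi: "\<phi> = (\<lambda>z. b z / a z)" "\<phi> \<in> hardy2"
  shows "reproducing_kernel_hilbert_space disk (de_branges_rovnyak_kernel b) (model_space \<phi>) (model_ip \<phi>)"
proof -
  define T where "T f = correlation (tcoeff \<phi>) (tcoeff f)" for f
  have p: "square_summable (tcoeff \<phi>)" using phi(2) by (simp add: hardy2_iff)
  have mem: "f \<in> model_space \<phi> \<longleftrightarrow> f holomorphic_on disk \<and> square_summable (tcoeff f) \<and> square_summable (T f)" for f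
    by (auto simp: model_space_def hardy2_iff T_def)
  have ip: "model_ip \<phi> f g = l2_inner (tcoeff f) (tcoeff g) + l2_inner (T f) (T g)" for f g
    by (simp add: model_ip_def T_def)
  have add: "tcoeff (\<lambda>x. f x + g x) = (\<lambda>n. tcoeff f n + tcoeff g n)" "T (\<lambda>x. f x + g x) = (\<lambda>n. T f n + T g n)"
    if "f \<in> model_space \<phi>" "g \<in> model_space \<phi>" for f g
  proof -
    show *: "tcoeff (\<lambda>x. f x + g x) = (\<lambda>n. tcoeff f n + tcoeff g n)"
      using that by (intro tcoeff_add) (auto simp: mem)
    show "T (\<lambda>x. f x + g x) = (\<lambda>n. T f n + T g n)"
      unfolding T_def * using that by (intro correlation_add p) (auto simp: mem)
  qed
  have diff: "tcoeff (\<lambda>x. f x - g x) = (\<lambda>n. tcoeff f n - tcoeff g n)" "T (\<lambda>x. f x - g x) = (\<lambda>n. T f n - T g n)"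
    if "f \<in> model_space \<phi>" "g \<in> model_space \<phi>" for f g
  proof -
    show *: "tcoeff (\<lambda>x. f x - g x) = (\<lambda>n. tcoeff f n - tcoeff g n)"
      using that by (intro tcoeff_diff) (auto simp: mem)
    show "T (\<lambda>x. f x - g x) = (\<lambda>n. T f n - T g n)"
      unfolding T_def * using that by (intro correlation_diff p) (auto simp: mem)
  qed
  have scale: "tcoeff (\<lambda>x. c * f x) = (\<lambda>n. c * tcoeff f n)" "T (\<lambda>x. c * f x) = (\<lambda>n. c * T f n)"
    if "f \<in> model_space \<phi>" for f c
  proof -
    show *: "tcoeff (\<lambda>x. c * f x) = (\<lambda>n. c * tcoeff f n)"
      using that by (intro tcoeff_scale) (auto simp: mem)
    show "T (\<lambda>x. c * f x) = (\<lambda>n. c * T f n)"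
      unfolding T_def * using that by (intro correlation_scale p) (auto simp: mem)
  qed
  have cong: "tcoeff g = tcoeff f" "T g = T f"
    if "f \<in> model_space \<phi>" "\<And>x. x \<in> disk \<Longrightarrow> g x = f x" for f g
  proof -
    show "tcoeff g = tcoeff f"
      using that by (intro tcoeff_cong[symmetric]) (auto simp: mem)
    then show "T g = T f" by (simp only: T_def)
  qed
  show ?thesis
  proof
    fix f g assume *: "f \<in> model_space \<phi>" "\<And>x. x \<in> disk \<Longrightarrow> g x = f x"
    then have "g holomorphic_on disk"
      using holomorphic_cong[OF refl, of disk g f] by (simp add: mem)
    then show "g \<in> model_space \<phi>"
      using *(1) arg_cong[OF cong(1)[OF *], of square_summable] arg_cong[OF cong(2)[OF *], of square_summable]
      unfolding mem by blast
  next
    show "(\<lambda>_. 0) \<in> model_space \<phi>"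
      unfolding mem T_def tcoeff_zero correlation_zero by simp
  next
    fix f g assume "f \<in> model_space \<phi>" "g \<in> model_space \<phi>"
    then show "(\<lambda>x. f x + g x) \<in> model_space \<phi>"
      unfolding mem[of "\<lambda>x. f x + g x"] add[OF \<open>f \<in> model_space \<phi>\<close> \<open>g \<in> model_space \<phi>\<close>]
      by (auto simp: mem intro!: holomorphic_intros square_summable_add)
  next
    fix f c assume "f \<in> model_space \<phi>"
    then show "(\<lambda>x. c * f x) \<in> model_space \<phi>"
      unfolding mem[of "\<lambda>x. c * f x"] scale[OF \<open>f \<in> model_space \<phi>\<close>]
      by (auto simp: mem intro!: holomorphic_intros square_summable_scale)
  next
    fix f g h assume *: "f \<in> model_space \<phi>" "g \<in> model_space \<phi>" "h \<in> model_space \<phi>"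
    show "model_ip \<phi> (\<lambda>x. f x + g x) h = model_ip \<phi> f h + model_ip \<phi> g h"
      unfolding ip add[OF *(1,2)] using * by (simp add: mem l2_inner_add_left)
  next
    fix f g c assume *: "f \<in> model_space \<phi>" "g \<in> model_space \<phi>"
    show "model_ip \<phi> (\<lambda>x. c * f x) g = c * model_ip \<phi> f g"
      unfolding ip scale[OF *(1)] using * by (simp add: mem l2_inner_scale_left distrib_left)
  next
    fix f g assume *: "f \<in> model_space \<phi>" "g \<in> model_space \<phi>"
    show "model_ip \<phi> f g = cnj (model_ip \<phi> g f)"
      unfolding ip complex_cnj_add using * by (intro arg_cong2[of _ _ _ _ "(+)"] l2_inner_commute) (auto simp: mem)
  next
    fix f assume f: "f \<in> model_space \<phi>"
    show "0 \<le> Re (model_ip \<phi> f f)"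
      unfolding model_ip_self[OF f] by (simp del: of_real_add)
  next
    fix f assume f: "f \<in> model_space \<phi>"
    show "model_ip \<phi> f f = 0 \<longleftrightarrow> (\<forall>x\<in>disk. f x = 0)"
    proof
      assume "model_ip \<phi> f f = 0"
      then have "(l2_norm (tcoeff f))\<^sup>2 + (l2_norm (T f))\<^sup>2 = 0"
        unfolding model_ip_self[OF f] T_def using of_real_eq_0_iff by blast
      then have "l2_norm (tcoeff f) = 0" by (simp add: add_nonneg_eq_0_iff)
      then have "tcoeff f n = 0" for n
        using component_le_l2_norm[of "tcoeff f" n] f by (simp add: mem)
      then show "\<forall>x\<in>disk. f x = 0"
        using tcoeff_sums[of f] f by (auto simp: mem sums_iff)
    next
      assume "\<forall>x\<in>disk. f x = 0"
      then have "tcoeff f = tcoeff (\<lambda>_. 0)" "T f = T (\<lambda>_. 0)"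
        using f by (auto intro!: tcoeff_cong simp: mem T_def simp del: correlation_zero intro!: arg_cong[of _ _ "correlation _"])
      then show "model_ip \<phi> f f = 0"
        unfolding ip T_def tcoeff_zero correlation_zero by (simp add: l2_inner_def)
    qed
  next
    fix F :: "nat \<Rightarrow> complex \<Rightarrow> complex"
    assume F: "\<And>n. F n \<in> model_space \<phi>"
      and Cauchy: "\<And>e. 0 < e \<Longrightarrow> \<exists>N. \<forall>m\<ge>N. \<forall>n\<ge>N.
        sqrt (Re (model_ip \<phi> (\<lambda>x. F m x - F n x) (\<lambda>x. F m x - F n x))) < e"
    have norm: "sqrt (Re (model_ip \<phi> (\<lambda>x. f x - g x) (\<lambda>x. f x - g x))) =
        sqrt ((l2_norm (\<lambda>n. tcoeff f n - tcoeff g n))\<^sup>2 + (l2_norm (\<lambda>n. T f n - T g n))\<^sup>2)"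
      if "f \<in> model_space \<phi>" "g \<in> model_space \<phi>" for f g
      unfolding ip diff[OF that] using that
      by (simp add: mem l2_inner_self square_summable_diff del: of_real_power)
    have sq: "square_summable (tcoeff (F n))" "square_summable (T (F n))" for n
      using F[of n] by (auto simp: mem)
    \<comment> \<open>The graph norm dominates both components, so coefficients and
      \<open>T\<close>-images are Cauchy separately.\<close>
    have le: "x \<le> sqrt (x\<^sup>2 + y\<^sup>2)" "y \<le> sqrt (x\<^sup>2 + y\<^sup>2)" for x y :: real
      by (simp_all add: real_le_rsqrt)
    have "\<exists>N. \<forall>m\<ge>N. \<forall>k\<ge>N. l2_norm (\<lambda>n. tcoeff (F m) n - tcoeff (F k) n) < e" if "0 < e" for e
      using Cauchy[OF that] unfolding norm[OF F F] by (meson le(1) le_less_trans)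
    from l2_complete[OF sq(1) this] obtain y where
      y: "square_summable y" "(\<lambda>k. l2_norm (\<lambda>n. tcoeff (F k) n - y n)) \<longlonglongrightarrow> 0" by blast
    have "\<exists>N. \<forall>m\<ge>N. \<forall>k\<ge>N. l2_norm (\<lambda>n. T (F m) n - T (F k) n) < e" if "0 < e" for e
      using Cauchy[OF that] unfolding norm[OF F F] by (meson le(2) le_less_trans)
    from l2_complete[OF sq(2) this] obtain v where
      v: "square_summable v" "(\<lambda>k. l2_norm (\<lambda>n. T (F k) n - v n)) \<longlonglongrightarrow> 0" by blast
    obtain f where f: "f \<in> hardy2" "tcoeff f = y"
      using hardy2_of_coefficients[OF y(1)] by blast
    \<comment> \<open>Closedness of \<open>T\<close>: each entry of \<open>T (F k)\<close> converges
      to that of \<open>T f\<close> as a bounded functional of the coefficients, and to that of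
      \<open>v\<close> by norm convergence.\<close>
    have Tf: "T f = v"
    proof
      fix m
      have "(\<lambda>k. l2_inner (tcoeff (F k)) (shift_right m (tcoeff \<phi>))) \<longlonglongrightarrow> l2_inner y (shift_right m (tcoeff \<phi>))"
        by (rule l2_inner_tendsto[OF sq(1) y(1) square_summable_shift_right[OF p] y(2)])
      then have "(\<lambda>k. T (F k) m) \<longlonglongrightarrow> T f m"
        unfolding T_def correlation_eq_inner[OF sq(1) p] f(2) correlation_eq_inner[OF y(1) p] .
      moreover have "(\<lambda>k. T (F k) m) \<longlonglongrightarrow> v m"
      proof (rule LIM_zero_cancel, rule Lim_null_comparison[OF _ v(2)])
        show "\<forall>\<^sub>F k in sequentially. norm (T (F k) m - v m) \<le> l2_norm (\<lambda>n. T (F k) n - v n)"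
          using component_le_l2_norm[OF square_summable_diff[OF sq(2) v(1)]] by simp
      qed
      ultimately show "T f m = v m" by (rule LIMSEQ_unique)
    qed
    have fm: "f \<in> model_space \<phi>"
      using f y v Tf unfolding mem by (simp add: hardy2_iff)
    have "(\<lambda>k. sqrt ((l2_norm (\<lambda>n. tcoeff (F k) n - y n))\<^sup>2 + (l2_norm (\<lambda>n. T (F k) n - v n))\<^sup>2))
        \<longlonglongrightarrow> sqrt (0\<^sup>2 + 0\<^sup>2)"
      by (intro tendsto_intros y v)
    then have "(\<lambda>n. sqrt (Re (model_ip \<phi> (\<lambda>x. F n x - f x) (\<lambda>x. F n x - f x)))) \<longlonglongrightarrow> 0"
      unfolding norm[OF F fm] Tf fun_cong[OF f(2)] by simp
    then show "\<exists>f\<in>model_space \<phi>. (\<lambda>n. sqrt (Re (model_ip \<phi> (\<lambda>x. F n x - f x) (\<lambda>x. F n x - f x)))) \<longlonglongrightarrow> 0"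
      using fm by blast
  next
    fix w assume "w \<in> disk"
    then have w: "cmod w < 1" by simp
    have b: "b \<in> hardy_infinity" and a: "a \<in> hardy_infinity"
      using ba by (auto simp: pythagorean_pair_def)
    have k2: "szego w \<in> hardy2" by (intro hardy_infinity_subset_hardy2 szego w)
    have bk2: "(\<lambda>z. b z * szego w z) \<in> hardy2" by (intro hardy_infinity_mult_hardy2 b k2)
    have ak: "(\<lambda>z. a z * szego w z) \<in> hardy_infinity" by (intro hardy_infinity_mult a szego w)
    have ak2: "(\<lambda>z. a z * szego w z) \<in> hardy2" by (intro hardy_infinity_subset_hardy2 ak)
    define K where "K z = de_branges_rovnyak_kernel b z w" for z
    have hol: "szego w holomorphic_on disk" "(\<lambda>z. b z * szego w z) holomorphic_on disk"
      using k2 bk2 by (auto simp: hardy2_iff)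
    have K_hol: "K holomorphic_on disk"
      unfolding K_def[abs_def] de_branges_rovnyak_kernel_szego by (intro holomorphic_intros hol)
    have K: "tcoeff K = (\<lambda>n. tcoeff (szego w) n - cnj (b w) * tcoeff (\<lambda>z. b z * szego w z) n)"
      unfolding K_def[abs_def] de_branges_rovnyak_kernel_szego
      by (rule tcoeff_diff_scale[OF hol])
    have TK: "T K = (\<lambda>m. cnj (b w) * tcoeff (\<lambda>z. a z * szego w z) m)"
      unfolding T_def K_def[abs_def] phi(1)
      by (rule correlation_kernel[OF ba _ w]) (use phi in simp)
    have sq: "square_summable (tcoeff (szego w))" "square_summable (tcoeff (\<lambda>z. b z * szego w z))"
      "square_summable (tcoeff (\<lambda>z. a z * szego w z))"
      using k2 bk2 ak2 by (auto simp: hardy2_iff)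
    have "K \<in> model_space \<phi>"
      unfolding mem K TK using K_hol sq by (auto intro!: square_summable_diff square_summable_scale)
    then show "(\<lambda>z. de_branges_rovnyak_kernel b z w) \<in> model_space \<phi>"
      by (simp add: K_def[abs_def])
    fix f assume f: "f \<in> model_space \<phi>"
    have f2: "f \<in> hardy2" and fT: "square_summable (tcoeff f)" "square_summable (T f)"
      using f by (auto simp: mem hardy2_iff)
    have "l2_inner (T f) (tcoeff (\<lambda>z. a z * szego w z)) = l2_inner (tcoeff f) (tcoeff (\<lambda>z. \<phi> z * (a z * szego w z)))"
      unfolding T_def using fT by (intro correlation_adjoint phi f2 ak) (simp add: T_def)
    \<comment> \<open>\<open>\<phi> * a = b\<close> on the disk, where \<open>a\<close> has no
      zeros.\<close>
    also have "tcoeff (\<lambda>z. \<phi> z * (a z * szego w z)) = tcoeff (\<lambda>z. b z * szego w z)"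
      by (rule tcoeff_cong[symmetric, OF hol(2)])
        (use pythagorean_inverse_hardy2(2)[OF ba] phi in simp)
    finally have adj: "l2_inner (T f) (tcoeff (\<lambda>z. a z * szego w z)) = l2_inner (tcoeff f) (tcoeff (\<lambda>z. b z * szego w z))" .
    \<comment> \<open>The first inner product contributes
      \<open>f w - b w * <f, b * szego w>\<close>; by the adjoint identity the second contributes
      the opposite of the extra term.\<close>
    have "model_ip \<phi> f K = f w"
      unfolding ip K TK using sq fT adj szego_reproducing[OF f2 w]
      by (simp add: l2_inner_diff_right l2_inner_scale_right square_summable_scale)
    then show "model_ip \<phi> f (\<lambda>z. de_branges_rovnyak_kernel b z w) = f w"
      by (simp add: K_def[abs_def])
  qed
qed

section \<open>Summability, membership and the norm formula\<close>

theorem theorem3p1: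
  fixes a b f :: "complex \<Rightarrow> complex"
    and Hb :: "(complex \<Rightarrow> complex) set"
    and ip :: "(complex \<Rightarrow> complex) \<Rightarrow> (complex \<Rightarrow> complex) \<Rightarrow> complex"
  defines "\<phi> \<equiv> \<lambda>z. b z / a z"
  assumes "pythagorean_pair b a"
    and "\<phi> \<in> hardy2"
    and "f \<in> hardy2"
    and "is_de_branges_rovnyak_space b Hb ip"
  shows "(\<forall>m::int. summable (\<lambda>n::nat. cmod (cnj (taylor_coeff \<phi> (int n)) * taylor_coeff f (m + int n))))
    \<and> (f \<in> Hb \<longleftrightarrow>
        summable (\<lambda>m::nat. (cmod (\<Sum>n::nat. cnj (taylor_coeff \<phi> (int n)) * taylor_coeff f (int m + int n)))\<^sup>2))
    \<and> (f \<in> Hb \<longrightarrow>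
        (ip_norm ip f)\<^sup>2 =
          (\<Sum>m::nat. (cmod (taylor_coeff f (int m)))\<^sup>2)
          + (\<Sum>m::nat. (cmod (\<Sum>n::nat. cnj (taylor_coeff \<phi> (int n)) * taylor_coeff f (int m + int n)))\<^sup>2))"
proof -
  have sq: "square_summable (tcoeff \<phi>)" "square_summable (tcoeff f)"
    using assms(3,4) by (auto simp: hardy2_iff)
  have T: "(\<Sum>n. cnj (tcoeff \<phi> n) * taylor_coeff f (int m + int n)) = correlation (tcoeff \<phi>) (tcoeff f) m" for m
    by (simp add: correlation_def)
  have i: "summable (\<lambda>n. cmod (cnj (tcoeff \<phi> n) * taylor_coeff f (m + int n)))" for m
  proof -
    have "square_summable (\<lambda>n. taylor_coeff f (m + int n))"
    proof (cases "0 \<le> m")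
      case True
      then obtain k where "m = int k" using nonneg_int_cases by blast
      then show ?thesis using square_summable_shift[of "tcoeff f" k] sq(2) by simp
    next
      case False
      \<comment> \<open>For negative \<open>m\<close>, shifting by \<open>k\<close> recovers the
        coefficients of \<open>f\<close>; the finitely many leading terms do not affect
        summability.\<close>
      then obtain k where k: "m = - int k" by (metis int_cases2 nle_le of_nat_0_le_iff)
      have "square_summable (\<lambda>n. taylor_coeff f (m + int (k + n)))" using sq(2) k by simp
      then show ?thesis using square_summable_shift[of "\<lambda>n. taylor_coeff f (m + int n)" k] by simp
    qed
    from summable_norm_mult[OF sq(1) this] show ?thesis by (simp add: norm_mult)
  qed
  have rkhs: "reproducing_kernel_hilbert_space disk (de_branges_rovnyak_kernel b) Hb ip"
    using assms(5) by (simp add: is_de_branges_rovnyak_space_def)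
  have model: "reproducing_kernel_hilbert_space disk (de_branges_rovnyak_kernel b) (model_space \<phi>) (model_ip \<phi>)"
    using assms(2,3) by (intro model_space_rkhs) (simp_all add: \<phi>_def)
  \<comment> \<open>\<open>Hb\<close> is an arbitrary Hilbert space with the given kernel;
    uniqueness identifies it with the model space, where membership of \<open>f\<close> means
    square-summability of \<open>T f\<close>.\<close>
  have mem: "f \<in> Hb \<longleftrightarrow> square_summable (correlation (tcoeff \<phi>) (tcoeff f))"
    unfolding rkhs_unique(1)[OF rkhs model] model_space_def using assms(4) by simp
  have "(ip_norm ip f)\<^sup>2 = (l2_norm (tcoeff f))\<^sup>2 + (l2_norm (correlation (tcoeff \<phi>) (tcoeff f)))\<^sup>2" if "f \<in> Hb"
  proof -
    have "f \<in> model_space \<phi>" using that rkhs_unique(1)[OF rkhs model] by blast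
    then show ?thesis
      unfolding rkhs_unique(2)[OF rkhs model that]
      unfolding ip_norm_def model_ip_self[OF \<open>f \<in> model_space \<phi>\<close>] by simp
  qed
  then have "f \<in> Hb \<Longrightarrow> (ip_norm ip f)\<^sup>2 = (\<Sum>m. (cmod (tcoeff f m))\<^sup>2)
      + (\<Sum>m. (cmod (correlation (tcoeff \<phi>) (tcoeff f) m))\<^sup>2)"
    using sq(2) mem by (simp add: l2_norm_square)
  then show ?thesis
    using i mem unfolding T square_summable_def by blast
qed

end
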